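(* Let $X$ be a compact metric space and $f:X\dashrightarrow X$ a continuous open-dense defined map which is good with respect to iterates. 1) If $\hat\mu$ is a positive strong submeasure on $\Gamma_{f,\infty}$ with $(\sigma_f)_*(\hat\mu)=\hat\mu$, then $\mu=(\pi_1)_*(\hat\mu)$ satisfies $f_*(\mu)\ge\mu$. 2) If $0\ne\mu_0\in SM^+(X)$ satisfies $f_*(\mu_0)=\mu_0$, then there exists a non-zero positive Borel measure $\hat\mu_0$ on $\Gamma_{f,\infty}$ with $(\sigma_f)_*(\hat\mu_0)=\hat\mu_0$, $\|\hat\mu_0\|=\|\mu_0\|$ and $(\pi_1)_*(\hat\mu_0)\le\mu_0$. Moreover the set $\{\hat\mu\in SM^+(\Gamma_{f,\infty}):(\pi_1)_*(\hat\mu)\le\mu_0,\ (\sigma_f)_*(\hat\mu)=\hat\mu\}$ has a largest element.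
   Context: Positive strong submeasures on a compact metric space $W$ ($SM^+(W)$): sub-linear, bounded, non-decreasing maps $C^0(W)\to\mathbb{R}$, with norm $\|\mu\|$ the least $C$ with $|\mu(\varphi)|\le C\|\varphi\|_{L^\infty}$; $\le$ is pointwise inequality. For continuous $g$, $g_*(\mu)(\varphi)=\mu(\varphi\circ g)$. For a continuous open-dense defined map $f:X\dashrightarrow X$ (continuous on the open dense set $\mathrm{OpenDom}(f)$, $I(f)$ its complement), $f_*(\mu)(\varphi)=\inf\{\mu(\psi):\psi\in C^0(X),\psi\ge E(\varphi\circ f)\}$, where $E(\varphi\circ f)$ equals $\varphi\circ f$ on $\mathrm{OpenDom}(f)$ and $\limsup_{y\in\mathrm{OpenDom}(f),y\to x}\varphi(f(y))$ at other $x$. $f$ is good with respect to iterates if $\Omega_{f,\infty}=\{x\in\mathrm{OpenDom}(f):f^n(x)\notin I(f)\ \forall n\}$ is dense and its complement nowhere dense. $\Gamma_{f,\infty}$ is the closure in $X^{\mathbb{N}}$ (product topology) of $\{(x,f(x),f^2(x),\ldots):x\in\Omega_{f,\infty}\}$, $\sigma_f$ the shift on it and $\pi_1$ the first-coordinate projection. *)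

theory Defs
  imports "HOL-Analysis.Analysis"
begin

definition sup_norm :: "'b set \<Rightarrow> ('b \<Rightarrow> real) \<Rightarrow> real" where
  "sup_norm W \<phi> = (if W = {} then 0 else (SUP x\<in>W. \<bar>\<phi> x\<bar>))"

text \<open>Positive strong submeasures on W: maps C^0(W) to R (only their values on
  functions continuous on W matter), sub-linear, bounded, non-decreasing.\<close>
definition SMpos :: "'b::topological_space set \<Rightarrow> (('b \<Rightarrow> real) \<Rightarrow> real) \<Rightarrow> bool" where
  "SMpos W \<mu> \<longleftrightarrow>
     (\<forall>\<phi> \<psi>. continuous_on W \<phi> \<longrightarrow> continuous_on W \<psi> \<longrightarrow>
        \<mu> (\<lambda>x. \<phi> x + \<psi> x) \<le> \<mu> \<phi> + \<mu> \<psi>) \<and>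
     (\<forall>c \<phi>. c \<ge> 0 \<longrightarrow> continuous_on W \<phi> \<longrightarrow> \<mu> (\<lambda>x. c * \<phi> x) = c * \<mu> \<phi>) \<and>
     (\<exists>C. \<forall>\<phi>. continuous_on W \<phi> \<longrightarrow> \<bar>\<mu> \<phi>\<bar> \<le> C * sup_norm W \<phi>) \<and>
     (\<forall>\<phi> \<psi>. continuous_on W \<phi> \<longrightarrow> continuous_on W \<psi> \<longrightarrow>
        (\<forall>x\<in>W. \<phi> x \<le> \<psi> x) \<longrightarrow> \<mu> \<phi> \<le> \<mu> \<psi>)"

definition sm_norm :: "'b::topological_space set \<Rightarrow> (('b \<Rightarrow> real) \<Rightarrow> real) \<Rightarrow> real" where
  "sm_norm W \<mu> = Inf {C. C \<ge> 0 \<and> (\<forall>\<phi>. continuous_on W \<phi> \<longrightarrow> \<bar>\<mu> \<phi>\<bar> \<le> C * sup_norm W \<phi>)}"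

definition sm_le :: "'b::topological_space set \<Rightarrow> (('b \<Rightarrow> real) \<Rightarrow> real) \<Rightarrow> (('b \<Rightarrow> real) \<Rightarrow> real) \<Rightarrow> bool" where
  "sm_le W \<mu> \<nu> \<longleftrightarrow> (\<forall>\<phi>. continuous_on W \<phi> \<longrightarrow> \<mu> \<phi> \<le> \<nu> \<phi>)"

definition sm_eq :: "'b::topological_space set \<Rightarrow> (('b \<Rightarrow> real) \<Rightarrow> real) \<Rightarrow> (('b \<Rightarrow> real) \<Rightarrow> real) \<Rightarrow> bool" where
  "sm_eq W \<mu> \<nu> \<longleftrightarrow> (\<forall>\<phi>. continuous_on W \<phi> \<longrightarrow> \<mu> \<phi> = \<nu> \<phi>)"

definition push :: "('b \<Rightarrow> 'c) \<Rightarrow> (('b \<Rightarrow> real) \<Rightarrow> real) \<Rightarrow> (('c \<Rightarrow> real) \<Rightarrow> real)" where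
  "push g \<mu> = (\<lambda>\<phi>. \<mu> (\<phi> \<circ> g))"

text \<open>A continuous open-dense defined map f : X --> X, modelled as a function f
  together with its domain D = OpenDom(f): D is open and dense in X, f is continuous
  on D and maps D into X. I(f) = X - D.\<close>
definition open_dense_map :: "'a::metric_space set \<Rightarrow> 'a set \<Rightarrow> ('a \<Rightarrow> 'a) \<Rightarrow> bool" where
  "open_dense_map X D f \<longleftrightarrow> openin (top_of_set X) D \<and> X \<subseteq> closure D \<and>
     continuous_on D f \<and> f ` D \<subseteq> X"

definition Omega_inf :: "'a set \<Rightarrow> 'a set \<Rightarrow> ('a \<Rightarrow> 'a) \<Rightarrow> 'a set" where
  "Omega_inf X D f = {x \<in> D. \<forall>n. (f ^^ n) x \<notin> X - D}"

definition good_wrt_iterates :: "'a::metric_space set \<Rightarrow> 'a set \<Rightarrow> ('a \<Rightarrow> 'a) \<Rightarrow> bool" where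
  "good_wrt_iterates X D f \<longleftrightarrow>
     X \<subseteq> closure (Omega_inf X D f) \<and>
     (top_of_set X) interior_of ((top_of_set X) closure_of (X - Omega_inf X D f)) = {}"

definition Gamma_inf :: "'a::metric_space set \<Rightarrow> 'a set \<Rightarrow> ('a \<Rightarrow> 'a) \<Rightarrow> (nat \<Rightarrow> 'a) set" where
  "Gamma_inf X D f = closure ((\<lambda>x. (\<lambda>n. (f ^^ n) x)) ` Omega_inf X D f)"

definition shift :: "(nat \<Rightarrow> 'a) \<Rightarrow> (nat \<Rightarrow> 'a)" where
  "shift s = (\<lambda>n. s (Suc n))"

definition proj1 :: "(nat \<Rightarrow> 'a) \<Rightarrow> 'a" where
  "proj1 s = s 0"

definition ext_comp :: "'a::metric_space set \<Rightarrow> ('a \<Rightarrow> 'a) \<Rightarrow> ('a \<Rightarrow> real) \<Rightarrow> 'a \<Rightarrow> ereal" where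
  "ext_comp D f \<phi> x = (if x \<in> D then ereal (\<phi> (f x))
                       else Limsup (at x within D) (\<lambda>y. ereal (\<phi> (f y))))"

definition fpush :: "'a::metric_space set \<Rightarrow> 'a set \<Rightarrow> ('a \<Rightarrow> 'a) \<Rightarrow> (('a \<Rightarrow> real) \<Rightarrow> real) \<Rightarrow> (('a \<Rightarrow> real) \<Rightarrow> real)" where
  "fpush X D f \<mu> = (\<lambda>\<phi>. Inf {\<mu> \<psi> | \<psi>. continuous_on X \<psi> \<and>
                                 (\<forall>x\<in>X. ext_comp D f \<phi> x \<le> ereal (\<psi> x))})"

end

theory Submission
  imports Defs
begin

text \<open>Every \<open>\<psi>\<close> dominating \<open>E(\<phi> \<circ> f)\<close> satisfies \<open>\<phi> (s 1) \<le> \<psi> (s 0)\<close> on the closure of the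
  orbits, which gives part 1. It also shows that \<open>p \<phi> = inf {\<mu>\<^sub>0 \<psi>. \<phi> \<le> \<psi> \<circ> \<pi>\<^sub>1}\<close> satisfies
  \<open>p (\<phi> \<circ> \<sigma>) \<le> p \<phi>\<close> when \<open>\<mu>\<^sub>0\<close> is \<open>f\<close>-invariant. Lowering \<open>p\<close> further to the infimum \<open>q \<phi>\<close> of
  \<open>p (\<phi> + \<psi> - \<psi> \<circ> \<sigma>)\<close> over all \<open>\<psi>\<close> keeps the value at 1, and every linear functional below \<open>q\<close>
  is shift-invariant. The Hahn--Banach and Riesz theorems turn this into the measure. The largest
  element is the pointwise supremum of all the competitors, of which the measure is one.\<close>

subsection \<open>The Hahn--Banach theorem for spaces of functions\<close>

text \<open>The obstacle is that \<open>\<phi> \<circ> f\<close> is in general not continuous on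
  \<open>X\<close>, so \<open>\<mu>\<^sub>0\<close> cannot be evaluated at it and
  \<open>fpush\<close> is only an infimum over continuous dominating functions. On the orbit space
  the dynamics becomes the shift, which is continuous everywhere on a compact space, and the whole
  link with \<open>f\<close> is one inequality between the coordinates 0 and 1. Invariance of
  \<open>\<mu>\<^sub>0\<close> makes \<open>p\<close> merely sub-invariant, and a linear functional
  below \<open>p\<close> need not be invariant. The infimum over coboundaries enforces this, because
  \<open>q\<close> is at most 0 both on \<open>\<phi> - \<phi> \<circ> \<sigma>\<close> and on its
  negative. The value at 1 is tracked because on a non-empty compact space it is the norm of a
  positive strong submeasure: keeping it gives at once the equality of norms and a non-zero measure.
  Positivity of the functional comes from monotonicity:
  \<open>L (- \<phi>) \<le> p (- \<phi>) \<le> p 0 = 0\<close> for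
  \<open>\<phi> \<ge> 0\<close>.\<close>

definition fun_subspace :: "('b \<Rightarrow> real) set \<Rightarrow> bool" where
  "fun_subspace V \<longleftrightarrow> (\<forall>u\<in>V. \<forall>v\<in>V. (\<lambda>x. u x + v x) \<in> V) \<and> (\<forall>c. \<forall>v\<in>V. (\<lambda>x. c * v x) \<in> V)"

definition sublinear_on :: "('b \<Rightarrow> real) set \<Rightarrow> (('b \<Rightarrow> real) \<Rightarrow> real) \<Rightarrow> bool" where
  "sublinear_on V p \<longleftrightarrow> (\<forall>u\<in>V. \<forall>v\<in>V. p (\<lambda>x. u x + v x) \<le> p u + p v) \<and>
     (\<forall>c\<ge>0. \<forall>v\<in>V. p (\<lambda>x. c * v x) = c * p v)"

definition linear_functional_on :: "('b \<Rightarrow> real) set \<Rightarrow> (('b \<Rightarrow> real) \<Rightarrow> real) \<Rightarrow> bool" where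
  "linear_functional_on V L \<longleftrightarrow> (\<forall>u\<in>V. \<forall>v\<in>V. L (\<lambda>x. u x + v x) = L u + L v) \<and>
     (\<forall>c. \<forall>v\<in>V. L (\<lambda>x. c * v x) = c * L v)"

lemma fun_subspace_add: "fun_subspace V \<Longrightarrow> u \<in> V \<Longrightarrow> v \<in> V \<Longrightarrow> (\<lambda>x. u x + v x) \<in> V"
  and fun_subspace_scale: "fun_subspace V \<Longrightarrow> v \<in> V \<Longrightarrow> (\<lambda>x. c * v x) \<in> V"
  by (auto simp: fun_subspace_def)

lemma fun_subspace_minus: "fun_subspace V \<Longrightarrow> v \<in> V \<Longrightarrow> (\<lambda>x. - v x) \<in> V"
  using fun_subspace_scale[of V v "-1"] by simp

lemma sublinear_onD:
  assumes "sublinear_on V p"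
  shows sublinear_on_add: "u \<in> V \<Longrightarrow> v \<in> V \<Longrightarrow> p (\<lambda>x. u x + v x) \<le> p u + p v"
    and sublinear_on_scale: "v \<in> V \<Longrightarrow> c \<ge> 0 \<Longrightarrow> p (\<lambda>x. c * v x) = c * p v"
  using assms by (auto simp: sublinear_on_def)

lemma sublinear_on_zero: "sublinear_on V p \<Longrightarrow> v \<in> V \<Longrightarrow> p (\<lambda>x. 0) = 0"
  using sublinear_on_scale[of V p v 0] by simp

lemma sublinear_on_minus:
  assumes "fun_subspace V" "sublinear_on V p" "v \<in> V"
  shows "- p (\<lambda>x. - v x) \<le> p v"
  using sublinear_on_add[OF assms(2,3) fun_subspace_minus[OF assms(1,3)]]
    sublinear_on_zero[OF assms(2,3)] by simp

text \<open>Common template for the four infima of the development: shrinking, chains, coboundaries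
  and \<open>pull\<close>. Only inequalities between competitors have to be checked, and
  \<open>scale\<close> only for positive \<open>t\<close>; the value at 0 is therefore a separate
  condition.\<close>

lemma sublinear_on_Inf:
  fixes S :: "('b \<Rightarrow> real) \<Rightarrow> real set"
  assumes V: "fun_subspace V"
    and ne: "\<And>v. v \<in> V \<Longrightarrow> S v \<noteq> {}"
    and bdd: "\<And>v. v \<in> V \<Longrightarrow> bdd_below (S v)"
    and add: "\<And>u v a b. u \<in> V \<Longrightarrow> v \<in> V \<Longrightarrow> a \<in> S u \<Longrightarrow> b \<in> S v \<Longrightarrow>
        \<exists>c\<in>S (\<lambda>x. u x + v x). c \<le> a + b"
    and scale: "\<And>v a t. v \<in> V \<Longrightarrow> a \<in> S v \<Longrightarrow> t > 0 \<Longrightarrow> \<exists>c\<in>S (\<lambda>x. t * v x). c \<le> t * a"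
    and zero: "Inf (S (\<lambda>x. 0)) = 0"
  shows "sublinear_on V (\<lambda>v. Inf (S v))"
proof -
  have lower: "Inf (S v) \<le> b" if "v \<in> V" "c \<in> S v" "c \<le> b" for v b c
    using cInf_lower[OF that(2) bdd[OF that(1)]] that(3) by linarith
  have pos: "Inf (S (\<lambda>x. t * v x)) \<le> t * Inf (S v)" if "t > 0" "v \<in> V" for t v
  proof -
    have "Inf (S (\<lambda>x. t * v x)) / t \<le> a" if "a \<in> S v" for a
      using scale[OF \<open>v \<in> V\<close> that \<open>t > 0\<close>] lower[OF fun_subspace_scale[OF V \<open>v \<in> V\<close>]] \<open>t > 0\<close>
      by (auto simp: field_simps)
    then have "Inf (S (\<lambda>x. t * v x)) / t \<le> Inf (S v)"
      using ne[OF \<open>v \<in> V\<close>] by (intro cInf_greatest)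
    then show ?thesis using \<open>t > 0\<close> by (simp add: field_simps)
  qed
  show ?thesis
    unfolding sublinear_on_def
  proof (intro conjI ballI allI impI)
    fix u v assume uv: "u \<in> V" "v \<in> V"
    let ?s = "Inf (S (\<lambda>x. u x + v x))"
    have "?s \<le> a + b" if ab: "a \<in> S u" "b \<in> S v" for a b
      using add[OF uv ab] lower[OF fun_subspace_add[OF V uv]] by blast
    then have "?s - b \<le> Inf (S u)" if "b \<in> S v" for b
      using ne[OF uv(1)] that by (intro cInf_greatest) (auto simp: algebra_simps)
    then have "?s - Inf (S u) \<le> Inf (S v)"
      using ne[OF uv(2)] by (intro cInf_greatest) (auto simp: algebra_simps)
    then show "?s \<le> Inf (S u) + Inf (S v)" by simp
  next
    fix t :: real and v assume t: "t \<ge> 0" and v: "v \<in> V"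
    show "Inf (S (\<lambda>x. t * v x)) = t * Inf (S v)"
    proof (cases "t = 0")
      case True
      then show ?thesis using zero by simp
    next
      case False
      with t have t: "t > 0" by simp
      \<comment> \<open>The converse inequality is \<open>pos\<close> itself, applied to
        \<open>t * v\<close> with the factor \<open>inverse t\<close>.\<close>
      have "Inf (S (\<lambda>x. inverse t * (t * v x))) \<le> inverse t * Inf (S (\<lambda>x. t * v x))"
        using t v V by (intro pos fun_subspace_scale) auto
      moreover have "(\<lambda>x. inverse t * (t * v x)) = v" using t by auto
      ultimately have "t * Inf (S v) \<le> Inf (S (\<lambda>x. t * v x))"
        using t by (simp add: field_simps)
      with pos[OF t v] show ?thesis by simp
    qed
  qed
qed

text \<open>At \<open>t = 0\<close> the new functional is seen to lie below \<open>p\<close>, and at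
  \<open>t = 1\<close> to be at most \<open>- p w\<close> at \<open>- w\<close>, which pushes it
  towards linearity in the direction \<open>w\<close>. The infimum is finite because
  \<open>t * p w = p (t * w)\<close> is at most \<open>p (v + t * w) + p (- v)\<close>.\<close>

lemma sublinear_on_shrink:
  assumes V: "fun_subspace V" and p: "sublinear_on V p" and w: "w \<in> V"
  defines "p' \<equiv> \<lambda>v. INF t\<in>{0::real..}. p (\<lambda>x. v x + t * w x) - t * p w"
  shows "sublinear_on V p'"
    and "\<And>v t. v \<in> V \<Longrightarrow> t \<ge> 0 \<Longrightarrow> p' v \<le> p (\<lambda>x. v x + t * w x) - t * p w"
proof -
  note add = fun_subspace_add[OF V] and scale = fun_subspace_scale[OF V] and minus = fun_subspace_minus[OF V]
  have lower: "- p (\<lambda>x. - v x) \<le> p (\<lambda>x. v x + t * w x) - t * p w" if "v \<in> V" "t \<ge> 0" for v t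
    using sublinear_on_add[OF p add[OF that(1) scale[OF w, of t]] minus[OF that(1)]]
      sublinear_on_scale[OF p w that(2)] by simp
  have bdd: "bdd_below ((\<lambda>t. p (\<lambda>x. v x + t * w x) - t * p w) ` {0..})" if "v \<in> V" for v
    using lower[OF that] by (intro bdd_belowI2[where m = "- p (\<lambda>x. - v x)"]) auto
  show le: "p' v \<le> p (\<lambda>x. v x + t * w x) - t * p w" if "v \<in> V" "t \<ge> 0" for v t
    unfolding p'_def using bdd[OF that(1)] that(2) by (intro cINF_lower) auto
  show "sublinear_on V p'"
    unfolding p'_def
  proof (rule sublinear_on_Inf[OF V _ bdd])
    fix u v a b assume uv: "u \<in> V" "v \<in> V"
      and ab: "a \<in> (\<lambda>t. p (\<lambda>x. u x + t * w x) - t * p w) ` {0..}"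
        "b \<in> (\<lambda>t. p (\<lambda>x. v x + t * w x) - t * p w) ` {0..}"
    from ab obtain t t' where t: "t \<ge> 0" "t' \<ge> 0"
      and a: "a = p (\<lambda>x. u x + t * w x) - t * p w" and b: "b = p (\<lambda>x. v x + t' * w x) - t' * p w"
      by auto
    have "p (\<lambda>x. (u x + t * w x) + (v x + t' * w x)) \<le> p (\<lambda>x. u x + t * w x) + p (\<lambda>x. v x + t' * w x)"
      using uv w by (intro sublinear_on_add[OF p] add scale)
    then show "\<exists>c\<in>(\<lambda>t. p (\<lambda>x. u x + v x + t * w x) - t * p w) ` {0..}. c \<le> a + b"
      unfolding a b using t by (intro bexI[OF _ imageI[of "t + t'"]]) (auto simp: algebra_simps)
  next
    fix v a and c :: real assume v: "v \<in> V" and c: "c > 0"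
      and "a \<in> (\<lambda>t. p (\<lambda>x. v x + t * w x) - t * p w) ` {0..}"
    then obtain t where t: "t \<ge> 0" and a: "a = p (\<lambda>x. v x + t * w x) - t * p w" by auto
    have "p (\<lambda>x. c * (v x + t * w x)) = c * p (\<lambda>x. v x + t * w x)"
      using v w c by (intro sublinear_on_scale[OF p] add scale) auto
    then show "\<exists>b\<in>(\<lambda>t. p (\<lambda>x. c * v x + t * w x) - t * p w) ` {0..}. b \<le> c * a"
      unfolding a using t c by (intro bexI[OF _ imageI[of "c * t"]]) (auto simp: algebra_simps)
  next
    have "p (\<lambda>x. 0 + t * w x) - t * p w = 0" if "t \<in> {0..}" for t
      using sublinear_on_scale[OF p w, of t] that by simp
    then have "(INF t\<in>{0::real..}. p (\<lambda>x. 0 + t * w x) - t * p w) = (INF t\<in>{0::real..}. 0)"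
      by (intro INF_cong) auto
    also have "\<dots> = 0" by (intro cINF_const) auto
    finally show "(INF t\<in>{0::real..}. p (\<lambda>x. 0 + t * w x) - t * p w) = 0" .
  qed simp
qed

text \<open>Functionals are required to vanish off \<open>V\<close> so that the pointwise order is antisymmetric on
  the set to which Zorn's lemma is applied.\<close>

lemma exists_minimal_sublinear_on:
  assumes V: "fun_subspace V" and q: "sublinear_on V q" and "w \<in> V"
  obtains m where "sublinear_on V m" "\<And>v. v \<in> V \<Longrightarrow> m v \<le> q v"
    "\<And>r. sublinear_on V r \<Longrightarrow> (\<And>v. v \<in> V \<Longrightarrow> r v \<le> m v) \<Longrightarrow> (\<And>v. v \<in> V \<Longrightarrow> r v = m v)"
proof -
  define A where "A = {p. sublinear_on V p \<and> (\<forall>v\<in>V. p v \<le> q v) \<and> (\<forall>v. v \<notin> V \<longrightarrow> p v = 0)}"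
  define P where "P = (\<lambda>a b :: ('a \<Rightarrow> real) \<Rightarrow> real. b \<le> a)"
  define cut where "cut = (\<lambda>(p :: ('a \<Rightarrow> real) \<Rightarrow> real) v. if v \<in> V then p v else 0)"
  have cut: "sublinear_on V (cut p)" if "sublinear_on V p" for p
    using that V by (simp add: sublinear_on_def cut_def fun_subspace_def)
  have "\<exists>m\<in>A. \<forall>a\<in>A. P m a \<longrightarrow> a = m"
  proof (rule predicate_Zorn)
    show "partial_order_on A (relation_of P A)"
      by (rule partial_order_on_relation_ofI) (auto simp: P_def)
  next
    fix C assume C: "C \<in> Chains (relation_of P A)"
    then have CA: "C \<subseteq> A" by (auto simp: Chains_def relation_of_def)
    have ch: "a \<le> b \<or> b \<le> a" if "a \<in> C" "b \<in> C" for a b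
      using C that by (auto simp: Chains_def relation_of_def P_def)
    show "\<exists>u\<in>A. \<forall>a\<in>C. P a u"
    proof (cases "C = {}")
      case True
      have "cut q \<in> A" using cut[OF q] by (auto simp: A_def cut_def)
      with True show ?thesis by auto
    next
      case False
      have sub: "sublinear_on V a" "v \<in> V \<Longrightarrow> a v \<le> q v" "v \<notin> V \<Longrightarrow> a v = 0" if "a \<in> C" for a v
        using that CA by (auto simp: A_def)
      \<comment> \<open>This bound depends on \<open>q\<close> alone, hence holds uniformly along
        the chain and makes the pointwise infimum finite.\<close>
      have "- q (\<lambda>x. - v x) \<le> a v" if "a \<in> C" "v \<in> V" for a v
        using sublinear_on_minus[OF V sub(1)[OF that(1)] that(2)]
          sub(2)[OF that(1) fun_subspace_minus[OF V that(2)]] by linarith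
      then have bdd: "bdd_below ((\<lambda>a. a v) ` C)" if "v \<in> V" for v
        using that by (intro bdd_belowI2[where m = "- q (\<lambda>x. - v x)"]) auto
      define u where "u = (\<lambda>v. INF a\<in>C. a v)"
      have "sublinear_on V u"
        unfolding u_def
      proof (rule sublinear_on_Inf[OF V _ bdd])
        fix u v a b assume uv: "u \<in> V" "v \<in> V" and "a \<in> (\<lambda>i. i u) ` C" "b \<in> (\<lambda>i. i v) ` C"
        then obtain i j where ij: "i \<in> C" "j \<in> C" and a: "a = i u" and b: "b = j v" by auto
        \<comment> \<open>Different members of the chain may nearly attain the infimum at
          \<open>u\<close> and at \<open>v\<close>; being comparable, the smaller one serves for
          both.\<close>
        from ch[OF ij] show "\<exists>c\<in>(\<lambda>i. i (\<lambda>x. u x + v x)) ` C. c \<le> a + b"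
        proof
          assume "i \<le> j"
          then have "i v \<le> j v" by (simp add: le_fun_def)
          with sublinear_on_add[OF sub(1)[OF ij(1)] uv] ij show ?thesis
            unfolding a b
            by (intro bexI[OF _ imageI[of i]]) auto
        next
          assume "j \<le> i"
          then have "j u \<le> i u" by (simp add: le_fun_def)
          with sublinear_on_add[OF sub(1)[OF ij(2)] uv] ij show ?thesis
            unfolding a b
            by (intro bexI[OF _ imageI[of j]]) auto
        qed
      next
        fix v a and c :: real assume "v \<in> V" "a \<in> (\<lambda>i. i v) ` C" "c > 0"
        then show "\<exists>b\<in>(\<lambda>i. i (\<lambda>x. c * v x)) ` C. b \<le> c * a"
          using sublinear_on_scale[OF sub(1)] by fastforce
      next
        have "(INF i\<in>C. i (\<lambda>x. 0)) = (INF i\<in>C. 0)"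
          using sublinear_on_zero[OF sub(1) \<open>w \<in> V\<close>] by (intro INF_cong) auto
        then show "(INF i\<in>C. i (\<lambda>x. 0)) = 0" using False by simp
      qed (simp add: False)
      then have "sublinear_on V (cut u)" by (rule cut)
      moreover have ule: "cut u v \<le> a v" if "a \<in> C" for a v
        using that cINF_lower[OF bdd, of v a] sub(3)[OF that] by (auto simp: cut_def u_def)
      moreover have "cut u v \<le> q v" if "v \<in> V" for v
        using False ule sub(2) that by (meson ex_in_conv order_trans)
      ultimately have "cut u \<in> A" "\<forall>a\<in>C. P a (cut u)"
        by (auto simp: A_def P_def le_fun_def cut_def)
      then show ?thesis by blast
    qed
  qed
  then obtain m where m: "m \<in> A" and min: "\<And>a. a \<in> A \<Longrightarrow> a \<le> m \<Longrightarrow> a = m"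
    by (auto simp: P_def)
  show ?thesis
  proof (rule that)
    show "sublinear_on V m" "\<And>v. v \<in> V \<Longrightarrow> m v \<le> q v" using m by (auto simp: A_def)
    fix r v assume r: "sublinear_on V r" "\<And>v. v \<in> V \<Longrightarrow> r v \<le> m v" and v: "v \<in> V"
    have "cut r \<in> A"
      using cut[OF r(1)] r(2) m unfolding A_def by (auto simp: cut_def intro: order_trans)
    moreover have "cut r \<le> m"
      using r(2) m by (auto simp: cut_def A_def le_fun_def)
    ultimately have "cut r = m" by (rule min)
    with v show "r v = m v" by (auto simp: cut_def)
  qed
qed

text \<open>Shrinking a minimal sublinear functional in any direction leaves it unchanged, which makes
  it superadditive.\<close>

theorem Hahn_Banach_functions:
  assumes V: "fun_subspace V" and p: "sublinear_on V p" and w: "w \<in> V"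
  obtains L where "linear_functional_on V L" "\<And>v. v \<in> V \<Longrightarrow> L v \<le> p v" "L w = p w"
proof -
  \<comment> \<open>Shrinking in the direction \<open>w\<close> before minimising fixes the value at
    \<open>w\<close>: a linear functional below \<open>q\<close> is at most \<open>- p w\<close> at
    \<open>- w\<close>, hence at least \<open>p w\<close> at \<open>w\<close>.\<close>
  define q where "q = (\<lambda>v. INF t\<in>{0::real..}. p (\<lambda>x. v x + t * w x) - t * p w)"
  have q: "sublinear_on V q" and qle: "\<And>v t. v \<in> V \<Longrightarrow> t \<ge> 0 \<Longrightarrow> q v \<le> p (\<lambda>x. v x + t * w x) - t * p w"
    unfolding q_def using sublinear_on_shrink[OF V p w] by blast+
  obtain m where m: "sublinear_on V m" and mq: "\<And>v. v \<in> V \<Longrightarrow> m v \<le> q v"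
    and min: "\<And>r v. sublinear_on V r \<Longrightarrow> (\<And>v. v \<in> V \<Longrightarrow> r v \<le> m v) \<Longrightarrow> v \<in> V \<Longrightarrow> r v = m v"
    using exists_minimal_sublinear_on[OF V q w] by (metis (no_types, lifting))
  have add: "m (\<lambda>x. u x + v x) = m u + m v" if uv: "u \<in> V" "v \<in> V" for u v
  proof -
    define r where "r = (\<lambda>u. INF t\<in>{0::real..}. m (\<lambda>x. u x + t * v x) - t * m v)"
    have r: "sublinear_on V r" "\<And>u t. u \<in> V \<Longrightarrow> t \<ge> 0 \<Longrightarrow> r u \<le> m (\<lambda>x. u x + t * v x) - t * m v"
      unfolding r_def using sublinear_on_shrink[OF V m uv(2)] by blast+
    have "r u \<le> m u" if "u \<in> V" for u using r(2)[OF that, of 0] by simp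
    from min[OF r(1) this uv(1)] r(2)[OF uv(1), of 1] have "m u \<le> m (\<lambda>x. u x + v x) - m v" by simp
    with sublinear_on_add[OF m uv] show ?thesis by linarith
  qed
  have neg: "m (\<lambda>x. - v x) = - m v" if "v \<in> V" for v
    using add[OF that fun_subspace_minus[OF V that]] sublinear_on_zero[OF m that] by simp
  have scale: "m (\<lambda>x. c * v x) = c * m v" if "v \<in> V" for c v
  proof (cases "c \<ge> 0")
    case True
    then show ?thesis using sublinear_on_scale[OF m that] by simp
  next
    case False
    then have "m (\<lambda>x. (- c) * (- v x)) = (- c) * m (\<lambda>x. - v x)"
      by (intro sublinear_on_scale[OF m fun_subspace_minus[OF V that]]) simp
    then show ?thesis using neg[OF that] by simp
  qed
  have mp: "m v \<le> p v" if "v \<in> V" for v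
    using mq[OF that] qle[OF that, of 0] by simp
  have "m (\<lambda>x. - w x) \<le> p (\<lambda>x. 0) - p w"
    using mq[of "\<lambda>x. - w x"] qle[of "\<lambda>x. - w x" 1] fun_subspace_minus[OF V w] by simp
  then have "p w \<le> m w"
    using neg[OF w] sublinear_on_zero[OF p w] by simp
  with mp[OF w] have "m w = p w" by simp
  with add scale mp show ?thesis by (intro that[of m]) (auto simp: linear_functional_on_def)
qed

subsection \<open>The Riesz representation theorem on compact metric spaces\<close>

lemma compact_continuous_bounded:
  fixes \<phi> :: "'b::metric_space \<Rightarrow> real"
  assumes "compact K" "continuous_on K \<phi>"
  obtains B where "B > 0" "\<And>x. x \<in> K \<Longrightarrow> \<bar>\<phi> x\<bar> \<le> B"
  using compact_imp_bounded[OF compact_continuous_image[OF assms(2,1)]]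
  by (auto simp: bounded_pos)

locale positive_functional =
  fixes K :: "'b::metric_space set" and L :: "('b \<Rightarrow> real) \<Rightarrow> real"
  assumes compact: "compact K"
    and linear: "linear_functional_on {\<phi>. continuous_on K \<phi>} L"
    and nonneg: "\<And>\<phi>. continuous_on K \<phi> \<Longrightarrow> (\<And>x. x \<in> K \<Longrightarrow> 0 \<le> \<phi> x) \<Longrightarrow> 0 \<le> L \<phi>"
begin

lemma L_add: "continuous_on K \<phi> \<Longrightarrow> continuous_on K \<psi> \<Longrightarrow> L (\<lambda>x. \<phi> x + \<psi> x) = L \<phi> + L \<psi>"
  and L_scale: "continuous_on K \<phi> \<Longrightarrow> L (\<lambda>x. c * \<phi> x) = c * L \<phi>"
  using linear by (auto simp: linear_functional_on_def)

lemma L_zero: "L (\<lambda>x. 0) = 0"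
  using L_scale[of "\<lambda>x. 0" 0] by simp

lemma L_diff:
  assumes "continuous_on K \<phi>" "continuous_on K \<psi>"
  shows "L (\<lambda>x. \<phi> x - \<psi> x) = L \<phi> - L \<psi>"
  using L_add[of \<phi> "\<lambda>x. -1 * \<psi> x"] L_scale[of \<psi> "-1"] assms
  by (simp add: continuous_on_minus)

lemma L_mono:
  assumes "continuous_on K \<phi>" "continuous_on K \<psi>" "\<And>x. x \<in> K \<Longrightarrow> \<phi> x \<le> \<psi> x"
  shows "L \<phi> \<le> L \<psi>"
  using nonneg[of "\<lambda>x. \<psi> x - \<phi> x"] L_diff[of \<psi> \<phi>] assms by (simp add: continuous_on_diff)

lemma L_sum:
  assumes "\<And>i. continuous_on K (\<phi> i)"
  shows "L (\<lambda>x. \<Sum>i<n::nat. \<phi> i x) = (\<Sum>i<n. L (\<phi> i))"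
  by (induction n) (simp_all add: L_zero L_add assms continuous_on_sum)

section \<open>The outer measure attached to a positive functional\<close>

definition majorants :: "'b set \<Rightarrow> (nat \<Rightarrow> 'b \<Rightarrow> real) set" where
  "majorants A = {\<phi>. (\<forall>n. continuous_on K (\<phi> n) \<and> (\<forall>x\<in>K. 0 \<le> \<phi> n x)) \<and>
     (\<forall>x\<in>A. 1 \<le> (\<Sum>n. ennreal (\<phi> n x)))}"

text \<open>This is the Daniell upper integral of the indicator of \<open>A\<close>. Covering by
  sequences of continuous functions instead of open sets turns countable subadditivity into a
  re-enumeration of double sequences.\<close>

definition outer :: "'b set \<Rightarrow> ennreal" where
  "outer A = (INF \<phi>\<in>majorants A. \<Sum>n. ennreal (L (\<phi> n)))"

lemma majorantsD:
  assumes "\<phi> \<in> majorants A"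
  shows "continuous_on K (\<phi> n)" "x \<in> K \<Longrightarrow> 0 \<le> \<phi> n x" "0 \<le> L (\<phi> n)"
    "x \<in> A \<Longrightarrow> 1 \<le> (\<Sum>n. ennreal (\<phi> n x))"
  using assms nonneg[of "\<phi> n"] by (auto simp: majorants_def)

lemma outer_mono: "A \<subseteq> B \<Longrightarrow> outer A \<le> outer B"
  unfolding outer_def by (rule INF_superset_mono) (auto simp: majorants_def)

lemma outer_le:
  assumes "continuous_on K \<phi>" "\<And>x. x \<in> K \<Longrightarrow> 0 \<le> \<phi> x" "\<And>x. x \<in> A \<Longrightarrow> 1 \<le> \<phi> x"
  shows "outer A \<le> ennreal (L \<phi>)"
proof -
  define \<psi> where "\<psi> = (\<lambda>n::nat. if n = 0 then \<phi> else (\<lambda>x. 0))"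
  have "(\<Sum>n. ennreal (\<psi> n x)) = ennreal (\<phi> x)" for x
    by (subst suminf_finite[of "{0}"]) (auto simp: \<psi>_def)
  then have "\<psi> \<in> majorants A"
    using assms by (auto simp: majorants_def \<psi>_def)
  then have "outer A \<le> (\<Sum>n. ennreal (L (\<psi> n)))"
    unfolding outer_def by (rule INF_lower)
  also have "\<dots> = ennreal (L \<phi>)"
    by (subst suminf_finite[of "{0}"]) (auto simp: \<psi>_def L_zero)
  finally show ?thesis .
qed

text \<open>Compactness enters here, through a Dini-type argument.\<close>

lemma outer_ge:
  assumes "continuous_on K \<phi>" "\<And>x. x \<in> K \<Longrightarrow> \<phi> x \<le> 1" "\<And>x. x \<in> K - A \<Longrightarrow> \<phi> x \<le> 0"
  shows "ennreal (L \<phi>) \<le> outer A"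
  unfolding outer_def
proof (rule INF_greatest)
  fix \<psi> assume \<psi>: "\<psi> \<in> majorants A"
  note cont = majorantsD(1)[OF \<psi>] and pos = majorantsD(2)[OF \<psi>]
  have L1: "0 \<le> L (\<lambda>x. 1)" by (intro nonneg) auto
  have unif: "\<exists>n. \<forall>x\<in>K. \<phi> x - e < (\<Sum>i<n. \<psi> i x)" if "e > 0" for e
  proof (rule ccontr)
    assume "\<not> ?thesis"
    then obtain x where x: "\<And>n. x n \<in> K" and le: "\<And>n. (\<Sum>i<n. \<psi> i (x n)) \<le> \<phi> (x n) - e"
      by (metis linorder_not_less)
    obtain l r where l: "l \<in> K" and r: "strict_mono r" "(x \<circ> r) \<longlonglongrightarrow> l"
      using compact x unfolding compact_def by blast
    have lim: "(\<lambda>k. u ((x \<circ> r) k)) \<longlonglongrightarrow> u l" if "continuous_on K u" for u :: "'b \<Rightarrow> real"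
      using that r(2) l by (rule continuous_on_tendsto_compose) (simp add: x)
    have part: "(\<Sum>i<m. \<psi> i l) \<le> \<phi> l - e" for m
    proof (rule LIMSEQ_le)
      show "(\<lambda>k. \<Sum>i<m. \<psi> i ((x \<circ> r) k)) \<longlonglongrightarrow> (\<Sum>i<m. \<psi> i l)"
        by (intro tendsto_sum lim cont)
      show "(\<lambda>k. \<phi> ((x \<circ> r) k) - e) \<longlonglongrightarrow> \<phi> l - e"
        by (intro tendsto_intros lim assms)
      have "(\<Sum>i<m. \<psi> i (x (r k))) \<le> \<phi> (x (r k)) - e" if "k \<ge> m" for k
      proof -
        \<comment> \<open>The point with index \<open>r k\<close> comes with a partial sum of length
          \<open>r k\<close>, which dominates the one of fixed length \<open>m\<close> since the
          terms are non-negative.\<close>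
        have "m \<le> r k" using that seq_suble[OF r(1), of k] by linarith
        then have "(\<Sum>i<m. \<psi> i (x (r k))) \<le> (\<Sum>i<r k. \<psi> i (x (r k)))"
          by (intro sum_mono2) (auto intro: pos x)
        with le[of "r k"] show ?thesis by linarith
      qed
      then show "\<exists>N. \<forall>k\<ge>N. (\<Sum>i<m. \<psi> i ((x \<circ> r) k)) \<le> \<phi> ((x \<circ> r) k) - e"
        by auto
    qed
    \<comment> \<open>The empty partial sum already gives \<open>\<phi> l \<ge> e > 0\<close>. So
      \<open>l\<close> lies in \<open>A\<close>, where the full series is at least 1, although it is
      bounded by \<open>\<phi> l - e < 1\<close>.\<close>
    from part[of 0] \<open>e > 0\<close> have "0 < \<phi> l" by simp
    with assms(3) l have "l \<in> A" by force
    then have "1 \<le> (\<Sum>n. ennreal (\<psi> n l))" by (rule majorantsD(4)[OF \<psi>])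
    also have "\<dots> \<le> ennreal (\<phi> l - e)"
    proof (rule suminf_le_const)
      fix m show "(\<Sum>n<m. ennreal (\<psi> n l)) \<le> ennreal (\<phi> l - e)"
        using part[of m] pos[OF l] by (simp add: ennreal_leI)
    qed simp
    finally have "1 \<le> \<phi> l - e" by (simp add: ennreal_ge_1)
    with assms(2)[OF l] \<open>e > 0\<close> show False by simp
  qed
  show "ennreal (L \<phi>) \<le> (\<Sum>n. ennreal (L (\<psi> n)))"
  proof (rule ennreal_le_epsilon)
    fix d :: real assume "d > 0"
    \<comment> \<open>The summand 1 keeps the denominator positive when \<open>L\<close> vanishes on
      constants.\<close>
    define e where "e = d / (L (\<lambda>x. 1) + 1)"
    have "e > 0" and e: "e * L (\<lambda>x. 1) \<le> d" using \<open>d > 0\<close> L1 by (auto simp: e_def field_simps)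
    obtain n where n: "\<And>x. x \<in> K \<Longrightarrow> \<phi> x - e < (\<Sum>i<n. \<psi> i x)" using unif[OF \<open>e > 0\<close>] by blast
    have "L \<phi> \<le> L (\<lambda>x. (\<Sum>i<n. \<psi> i x) + e * 1)"
      using n by (intro L_mono) (auto intro!: assms continuous_intros cont simp: less_eq_real_def algebra_simps)
    also have "\<dots> = L (\<lambda>x. \<Sum>i<n. \<psi> i x) + L (\<lambda>x. e * 1)"
      by (intro L_add continuous_intros cont)
    also have "\<dots> = (\<Sum>i<n. L (\<psi> i)) + e * L (\<lambda>x. 1)"
      using L_scale[of "\<lambda>x. 1" e] L_sum[of \<psi> n, OF cont] by simp
    also have "\<dots> \<le> (\<Sum>i<n. L (\<psi> i)) + d" using e by simp
    finally have "ennreal (L \<phi>) \<le> ennreal ((\<Sum>i<n. L (\<psi> i)) + d)" by (rule ennreal_leI)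
    also have "\<dots> = (\<Sum>i<n. ennreal (L (\<psi> i))) + ennreal d"
      using \<open>d > 0\<close> majorantsD(3)[OF \<psi>] by (simp add: ennreal_plus sum_nonneg)
    also have "\<dots> \<le> (\<Sum>n. ennreal (L (\<psi> n))) + ennreal d"
      by (intro add_right_mono sum_le_suminf) auto
    finally show "ennreal (L \<phi>) \<le> (\<Sum>n. ennreal (L (\<psi> n))) + ennreal d" .
  qed
qed

lemma outer_empty: "outer {} = 0"
  using outer_le[of "\<lambda>x. 0" "{}"] by (simp add: L_zero)

lemma outer_close:
  assumes "outer A < top" "e > 0"
  obtains \<phi> where "\<phi> \<in> majorants A" "(\<Sum>n. ennreal (L (\<phi> n))) \<le> outer A + ennreal e"
proof -
  have "outer A < outer A + ennreal e" using assms by (auto simp: less_top)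
  then show ?thesis using that unfolding outer_def INF_less_iff by (meson less_imp_le)
qed

text \<open>Near-optimal majorants of the sets \<open>A i\<close>, with errors
  \<open>e / 2 ^ (i + 1)\<close> that add up to \<open>e\<close>, are merged into one sequence by
  enumerating pairs of indices.\<close>

lemma outer_subadditive:
  fixes A :: "nat \<Rightarrow> 'b set"
  shows "outer (\<Union>i. A i) \<le> (\<Sum>i. outer (A i))"
proof (rule ennreal_le_epsilon)
  fix e :: real assume "(\<Sum>i. outer (A i)) < top" "0 < e"
  then have "outer (A i) < top" for i by (auto dest!: ennreal_suminf_lessD)
  then have "\<exists>\<phi>. \<phi> \<in> majorants (A i) \<and> (\<Sum>n. ennreal (L (\<phi> n))) \<le> outer (A i) + ennreal (e * (1/2) ^ Suc i)" for i
    using outer_close[of "A i" "e * (1/2) ^ Suc i"] \<open>0 < e\<close>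
    by (metis half_gt_zero_iff mult_pos_pos zero_less_numeral zero_less_one zero_less_power)
  then obtain \<phi> where \<phi>: "\<And>i. \<phi> i \<in> majorants (A i)"
    and le: "\<And>i. (\<Sum>n. ennreal (L (\<phi> i n))) \<le> outer (A i) + ennreal (e * (1/2) ^ Suc i)"
    by metis
  define \<psi> where "\<psi> = case_prod \<phi> \<circ> prod_decode"
  \<comment> \<open>Stated for arbitrary \<open>F\<close> because the rearrangement is needed twice:
    for evaluation at a point and for \<open>L\<close>.\<close>
  have sum\<psi>: "(\<Sum>k. F (\<psi> k)) = (\<Sum>i n. F (\<phi> i n))" for F :: "('b \<Rightarrow> real) \<Rightarrow> ennreal"
    using suminf_ennreal_2dimen[of "\<lambda>i. \<Sum>n. F (\<phi> i n)" "\<lambda>p. F (case_prod \<phi> p)"]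
    by (simp add: \<psi>_def)
  have "\<psi> \<in> majorants (\<Union>i. A i)"
    unfolding majorants_def
  proof safe
    fix n show "continuous_on K (\<psi> n)"
      using majorantsD(1)[OF \<phi>] by (simp add: \<psi>_def split: prod.split)
    fix x assume "x \<in> K" then show "0 \<le> \<psi> n x"
      using majorantsD(2)[OF \<phi>] by (simp add: \<psi>_def split: prod.split)
  next
    fix x i assume "x \<in> A i"
    then have "1 \<le> (\<Sum>n. ennreal (\<phi> i n x))" by (rule majorantsD(4)[OF \<phi>])
    also have "\<dots> \<le> (\<Sum>i n. ennreal (\<phi> i n x))"
      using sum_le_suminf[of "\<lambda>i. \<Sum>n. ennreal (\<phi> i n x)" "{i}"] by simp
    also have "\<dots> = (\<Sum>k. ennreal (\<psi> k x))"
      using sum\<psi>[of "\<lambda>f. ennreal (f x)"] by simp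
    finally show "1 \<le> (\<Sum>k. ennreal (\<psi> k x))" .
  qed
  then have "outer (\<Union>i. A i) \<le> (\<Sum>k. ennreal (L (\<psi> k)))"
    unfolding outer_def by (rule INF_lower)
  also have "\<dots> = (\<Sum>i n. ennreal (L (\<phi> i n)))" by (rule sum\<psi>)
  also have "\<dots> \<le> (\<Sum>i. outer (A i) + ennreal (e * (1/2) ^ Suc i))"
    by (intro suminf_le le) auto
  also have "\<dots> = (\<Sum>i. outer (A i)) + (\<Sum>i. ennreal (e * (1/2) ^ Suc i))"
    by (intro suminf_add[symmetric]) auto
  also have "(\<Sum>i. ennreal (e * (1/2) ^ Suc i)) = ennreal e"
    using \<open>0 < e\<close> sums_mult[OF power_half_series, of e] by (intro suminf_ennreal_eq) auto
  finally show "outer (\<Union>i. A i) \<le> (\<Sum>i. outer (A i)) + ennreal e" .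
qed

section \<open>Measurability of relatively open sets\<close>

lemma outer_measure_space_outer: "outer_measure_space (Pow K) outer"
  unfolding outer_measure_space_def positive_def increasing_def countably_subadditive_def
  using outer_mono outer_subadditive outer_empty by auto

text \<open>With \<open>\<theta> k = min 1 (k * h)\<close>, a majorant \<open>\<phi>\<close> of \<open>A\<close> is split into \<open>\<phi> n * (1 - \<theta> N)\<close>, which
  majorises \<open>A\<close> off \<open>{h > 0}\<close>, and \<open>\<phi> n * \<theta> N\<close>. To cover \<open>A \<inter> {h > 0}\<close> the latter only lacks
  \<open>1 - \<theta> N\<close>, which is there the sum of the increments \<open>\<theta> (Suc k) - \<theta> k\<close> for \<open>k \<ge> N\<close>; as the
  increments have summable \<open>L\<close>-values, this costs arbitrarily little.\<close>

lemma outer_split: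
  fixes h :: "'b \<Rightarrow> real"
  assumes h: "continuous_on K h" "\<And>x. x \<in> K \<Longrightarrow> 0 \<le> h x" and "A \<subseteq> K"
  defines "U \<equiv> {x \<in> K. 0 < h x}"
  shows "outer (A \<inter> U) + outer (A - U) \<le> outer A"
proof (rule ennreal_le_epsilon)
  fix d :: real assume fin: "outer A < top" and "d > 0"
  \<comment> \<open>One half pays for the near-optimal majorant, the other for the tail of the
    increments.\<close>
  define e where "e = d / 2"
  have "e > 0" using \<open>d > 0\<close> by (simp add: e_def)
  obtain \<phi> where \<phi>: "\<phi> \<in> majorants A" and \<phi>le: "(\<Sum>n. ennreal (L (\<phi> n))) \<le> outer A + ennreal e"
    using outer_close[OF fin \<open>e > 0\<close>] .
  note cont\<phi> = majorantsD(1)[OF \<phi>] and pos\<phi> = majorantsD(2)[OF \<phi>]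
  define \<theta> where "\<theta> = (\<lambda>k x. min 1 (real k * h x))"
  have cont\<theta>: "continuous_on K (\<theta> k)" for k
    unfolding \<theta>_def by (intro continuous_intros h)
  have \<theta>01: "0 \<le> \<theta> k x" "\<theta> k x \<le> 1" and \<theta>mono: "\<theta> k x \<le> \<theta> (Suc k) x" if "x \<in> K" for k x
    using h(2)[OF that] by (auto simp: \<theta>_def min_def algebra_simps)
  have "incseq (\<lambda>k. L (\<theta> k))"
    by (intro incseq_SucI L_mono cont\<theta> \<theta>mono)
  moreover have "L (\<theta> k) \<le> L (\<lambda>x. 1)" for k
    by (intro L_mono cont\<theta> \<theta>01) auto
  ultimately obtain l where l: "(\<lambda>k. L (\<theta> k)) \<longlonglongrightarrow> l"
    using incseq_convergent by metis
  then obtain N where "\<bar>L (\<theta> N) - l\<bar> < e"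
    using LIMSEQ_D[OF l \<open>e > 0\<close>] by auto
  then have N: "l - L (\<theta> N) < e" by simp
  define g where "g = (\<lambda>k x. \<theta> (Suc (N + k)) x - \<theta> (N + k) x)"
  have contg: "continuous_on K (g k)" and posg: "x \<in> K \<Longrightarrow> 0 \<le> g k x" for k x
    unfolding g_def using \<theta>mono by (auto intro: continuous_on_diff cont\<theta>)
  have Lg: "(\<lambda>k. L (g k)) sums (l - L (\<theta> N))"
  proof -
    have "(\<lambda>k. L (\<theta> (N + Suc k)) - L (\<theta> (N + k))) sums (l - L (\<theta> (N + 0)))"
      by (intro telescope_sums) (use LIMSEQ_ignore_initial_segment[OF l, of N] in \<open>simp add: add.commute\<close>)
    then show ?thesis by (simp add: g_def L_diff cont\<theta>)
  qed
  have sumg: "(\<lambda>k. g k x) sums (1 - \<theta> N x)" if "x \<in> U" for x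
  proof -
    from that have hx: "0 < h x" by (simp add: U_def)
    obtain n :: nat where n: "1 / h x \<le> real n" using real_arch_simple by blast
    have "\<theta> k x = 1" if "k \<ge> n" for k
    proof -
      have "1 / h x \<le> real k" using n that by linarith
      then show ?thesis using hx by (simp add: \<theta>_def field_simps)
    qed
    then have "(\<lambda>k. \<theta> k x) \<longlonglongrightarrow> 1"
      by (intro tendsto_eventually) (auto simp: eventually_sequentially)
    then have "(\<lambda>k. \<theta> (N + Suc k) x - \<theta> (N + k) x) sums (1 - \<theta> (N + 0) x)"
      by (intro telescope_sums) (use LIMSEQ_ignore_initial_segment[of "\<lambda>k. \<theta> k x" 1 N] in \<open>simp add: add.commute\<close>)
    then show ?thesis by (simp add: g_def)
  qed
  \<comment> \<open>Only total sums count, so the increments may be added index by index instead of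
    being interleaved as further terms.\<close>
  define \<Phi> where "\<Phi> = (\<lambda>n x. \<phi> n x * \<theta> N x + g n x)"
  define \<Psi> where "\<Psi> = (\<lambda>n x. \<phi> n x * (1 - \<theta> N x))"
  have cont\<Phi>: "continuous_on K (\<Phi> n)" and cont\<Psi>: "continuous_on K (\<Psi> n)" for n
    unfolding \<Phi>_def \<Psi>_def by (intro continuous_intros cont\<phi> cont\<theta> contg)+
  have pos\<Phi>: "0 \<le> \<Phi> n x" and pos\<Psi>: "0 \<le> \<Psi> n x" if "x \<in> K" for n x
    using pos\<phi>[OF that] \<theta>01[OF that] posg[OF that] by (auto simp: \<Phi>_def \<Psi>_def)
  have "\<Phi> \<in> majorants (A \<inter> U)"
  proof -
    have "1 \<le> (\<Sum>n. ennreal (\<Phi> n x))" if x: "x \<in> A" "x \<in> U" for x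
    proof -
      have xK: "x \<in> K" using x(2) by (simp add: U_def)
      have "(\<Sum>n. ennreal (\<Phi> n x)) = (\<Sum>n. ennreal (\<phi> n x) * ennreal (\<theta> N x) + ennreal (g n x))"
        using pos\<phi>[OF xK] \<theta>01[OF xK] posg[OF xK] by (simp add: \<Phi>_def ennreal_mult)
      also have "\<dots> = (\<Sum>n. ennreal (\<phi> n x)) * ennreal (\<theta> N x) + (\<Sum>n. ennreal (g n x))"
        by (subst suminf_add[symmetric]) auto
      also have "(\<Sum>n. ennreal (g n x)) = ennreal (1 - \<theta> N x)"
        using posg[OF xK] sumg[OF x(2)] by (rule suminf_ennreal_eq)
      also have "(\<Sum>n. ennreal (\<phi> n x)) * ennreal (\<theta> N x) + ennreal (1 - \<theta> N x)
          \<ge> 1 * ennreal (\<theta> N x) + ennreal (1 - \<theta> N x)"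
        using majorantsD(4)[OF \<phi> x(1)] by (intro add_right_mono mult_right_mono) auto
      also have "1 * ennreal (\<theta> N x) + ennreal (1 - \<theta> N x) = 1"
        using \<theta>01[OF xK] by (simp flip: ennreal_plus)
      finally show ?thesis .
    qed
    then show ?thesis using cont\<Phi> pos\<Phi> by (auto simp: majorants_def)
  qed
  then have out\<Phi>: "outer (A \<inter> U) \<le> (\<Sum>n. ennreal (L (\<Phi> n)))"
    unfolding outer_def by (rule INF_lower)
  have "\<Psi> \<in> majorants (A - U)"
  proof -
    have "1 \<le> (\<Sum>n. ennreal (\<Psi> n x))" if x: "x \<in> A" "x \<notin> U" for x
    proof -
      have "h x = 0" using x h(2)[of x] \<open>A \<subseteq> K\<close> by (force simp: U_def)
      then have "\<theta> N x = 0" by (simp add: \<theta>_def)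
      then show ?thesis using majorantsD(4)[OF \<phi> x(1)] by (simp add: \<Psi>_def)
    qed
    then show ?thesis using cont\<Psi> pos\<Psi> by (auto simp: majorants_def)
  qed
  then have out\<Psi>: "outer (A - U) \<le> (\<Sum>n. ennreal (L (\<Psi> n)))"
    unfolding outer_def by (rule INF_lower)
  have "outer (A \<inter> U) + outer (A - U) \<le> (\<Sum>n. ennreal (L (\<Phi> n))) + (\<Sum>n. ennreal (L (\<Psi> n)))"
    using out\<Phi> out\<Psi> by (rule add_mono)
  also have "\<dots> = (\<Sum>n. ennreal (L (\<Phi> n)) + ennreal (L (\<Psi> n)))"
    by (intro suminf_add) auto
  \<comment> \<open>The weights \<open>\<theta> N\<close> and \<open>1 - \<theta> N\<close> add up
    to 1, so the increments are the only extra cost of the splitting.\<close>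
  also have "\<dots> = (\<Sum>n. ennreal (L (\<phi> n)) + ennreal (L (g n)))"
  proof -
    have "ennreal (L (\<Phi> n)) + ennreal (L (\<Psi> n)) = ennreal (L (\<phi> n)) + ennreal (L (g n))" for n
    proof -
      have "L (\<Phi> n) + L (\<Psi> n) = L (\<lambda>x. \<Phi> n x + \<Psi> n x)" by (simp add: L_add cont\<Phi> cont\<Psi>)
      also have "(\<lambda>x. \<Phi> n x + \<Psi> n x) = (\<lambda>x. \<phi> n x + g n x)"
        by (auto simp: \<Phi>_def \<Psi>_def algebra_simps)
      also have "L \<dots> = L (\<phi> n) + L (g n)" by (intro L_add cont\<phi> contg)
      finally show ?thesis
        using nonneg[OF cont\<Phi> pos\<Phi>] nonneg[OF cont\<Psi> pos\<Psi>] nonneg[OF cont\<phi> pos\<phi>] nonneg[OF contg posg]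
        by (simp flip: ennreal_plus)
    qed
    then show ?thesis by simp
  qed
  also have "\<dots> = (\<Sum>n. ennreal (L (\<phi> n))) + (\<Sum>n. ennreal (L (g n)))"
    by (intro suminf_add[symmetric]) auto
  also have "(\<Sum>n. ennreal (L (g n))) = ennreal (l - L (\<theta> N))"
    using nonneg[OF contg posg] Lg by (intro suminf_ennreal_eq) auto
  also have "(\<Sum>n. ennreal (L (\<phi> n))) + \<dots> \<le> (outer A + ennreal e) + ennreal e"
    using N by (intro add_mono \<phi>le ennreal_leI) simp
  also have "\<dots> = outer A + ennreal d"
    using \<open>e > 0\<close> by (simp add: e_def add.assoc flip: ennreal_plus)
  finally show "outer (A \<inter> U) + outer (A - U) \<le> outer A + ennreal d" .
qed

text \<open>A relatively open set is the positivity set of the distance to the complement, so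
  \<open>outer_split\<close> gives one half of the Caratheodory condition; the other half is
  subadditivity.\<close>

lemma open_in_lambda_system:
  assumes "open S"
  shows "K \<inter> S \<in> lambda_system K (Pow K) outer"
proof -
  interpret sigma_algebra K "Pow K" by (rule sigma_algebra_Pow)
  \<comment> \<open>By convention \<open>infdist\<close> to the empty set is 0, so the whole space
    needs its own positive function.\<close>
  define h where "h = (\<lambda>x. if S = UNIV then 1 else infdist x (- S))"
  have h: "continuous_on K h" "0 \<le> h x" for x
    by (cases "S = UNIV"; auto simp: h_def infdist_nonneg intro!: continuous_intros)+
  have "0 < h x \<longleftrightarrow> x \<in> S" for x
  proof (cases "S = UNIV")
    case False
    then have "infdist x (- S) = 0 \<longleftrightarrow> x \<in> - S"
      using assms by (intro in_closed_iff_infdist_zero[symmetric]) auto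
    then show ?thesis using False infdist_nonneg[of x "- S"] by (auto simp: h_def less_le)
  qed (simp add: h_def)
  then have U: "K \<inter> S = {x \<in> K. 0 < h x}" by auto
  show ?thesis
    unfolding lambda_system_eq
  proof (intro CollectI conjI ballI)
    fix A assume "A \<in> Pow K"
    then have A: "A \<subseteq> K" by simp
    have "outer A \<le> outer (A \<inter> (K \<inter> S)) + outer (A - K \<inter> S)"
    proof -
      \<comment> \<open>Padding with empty sets extracts subadditivity for two sets from the
        countable version.\<close>
      have "outer A = outer (\<Union>n::nat. if n = 0 then A \<inter> (K \<inter> S) else if n = 1 then A - K \<inter> S else {})"
        by (rule arg_cong[where f = outer]) (auto split: if_splits; metis zero_neq_one)
      also have "\<dots> \<le> (\<Sum>n::nat. outer (if n = 0 then A \<inter> (K \<inter> S) else if n = 1 then A - K \<inter> S else {}))"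
        by (rule outer_subadditive)
      also have "\<dots> = outer (A \<inter> (K \<inter> S)) + outer (A - K \<inter> S)"
        by (subst suminf_finite[of "{0, 1}"]) (auto simp: outer_empty)
      finally show ?thesis .
    qed
    with outer_split[OF h A] show "outer (A \<inter> (K \<inter> S)) + outer (A - K \<inter> S) = outer A"
      unfolding U by (intro antisym)
  qed auto
qed

text \<open>The measure lives on the relative Borel sets; the larger Caratheodory system only serves
  to show that \<open>outer\<close> is countably additive there.\<close>

definition rep :: "'b measure" where
  "rep = measure_of K (sets (restrict_space borel K)) outer"

lemma sets_rep: "sets rep = sets (restrict_space borel K)"
  and space_rep: "space rep = K"
proof -
  have "space (restrict_space borel K) = K" by (simp add: space_restrict_space)
  then have "sets (restrict_space borel K) \<subseteq> Pow K" 
    and "sigma_sets K (sets (restrict_space borel K)) = sets (restrict_space borel K)"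
    using sets.space_closed[of "restrict_space borel K"] sets.sigma_sets_eq[of "restrict_space borel K"] by auto
  then show "sets rep = sets (restrict_space borel K)" "space rep = K"
    by (simp_all add: rep_def sets_measure_of space_measure_of)
qed

lemma emeasure_rep:
  assumes "A \<in> sets (restrict_space borel K)"
  shows "emeasure rep A = outer A"
proof -
  interpret P: sigma_algebra K "Pow K" by (rule sigma_algebra_Pow)
  let ?\<Lambda> = "lambda_system K (Pow K) outer"
  have ms: "measure_space K ?\<Lambda> outer"
    by (rule P.caratheodory_lemma[OF outer_measure_space_outer])
  then have \<Lambda>: "sigma_algebra K ?\<Lambda>" "positive ?\<Lambda> outer" "countably_additive ?\<Lambda> outer"
    by (auto simp: measure_space_def)
  define N where "N = measure_of K ?\<Lambda> outer"
  have N: "sets N = ?\<Lambda>" "space N = K"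
    using \<Lambda>(1) by (auto simp: N_def sigma_algebra.sets_measure_of_eq sigma_algebra.space_measure_of_eq)
  \<comment> \<open>Measurability of the identity can be tested on open sets, and then puts every
    relative Borel set into the Caratheodory system at once.\<close>
  have "(\<lambda>x. x) \<in> borel_measurable N"
    using open_in_lambda_system by (intro borel_measurableI) (auto simp: N Int_commute)
  then have sub: "sets (restrict_space borel K) \<subseteq> ?\<Lambda>"
    using measurable_sets[of "\<lambda>x. x" N borel] by (auto simp: sets_restrict_space N Int_commute)
  show ?thesis
    unfolding rep_def
  proof (rule emeasure_measure_of_sigma[OF _ _ _ assms])
    show "sigma_algebra K (sets (restrict_space borel K))"
      using sets.sigma_algebra_axioms[of "restrict_space borel K"] by (simp add: space_restrict_space)
    show "positive (sets (restrict_space borel K)) outer"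
      using outer_empty by (simp add: positive_def)
    show "countably_additive (sets (restrict_space borel K)) outer"
      unfolding countably_additive_def
    proof (intro allI impI)
      fix A :: "nat \<Rightarrow> 'b set"
      assume "range A \<subseteq> sets (restrict_space borel K)" "disjoint_family A"
        and "(\<Union>i. A i) \<in> sets (restrict_space borel K)"
      then show "(\<Sum>i. outer (A i)) = outer (\<Union>i. A i)"
        using \<Lambda>(3) sub unfolding countably_additive_def by (meson order_trans subsetD)
    qed
  qed
qed

lemma emeasure_rep_space: "emeasure rep (space rep) \<le> ennreal (L (\<lambda>x. 1))"
proof -
  have "K \<in> sets (restrict_space borel K)"
    using sets.top[of rep] by (simp add: sets_rep space_rep)
  then show ?thesis using outer_le[of "\<lambda>x. 1" K] by (simp add: space_rep emeasure_rep)
qed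

sublocale rep: finite_measure rep
  using emeasure_rep_space by (intro finite_measureI) (auto simp: top_unique)

section \<open>Integrals of continuous functions against the representing measure\<close>

lemma measurable_rep: "continuous_on K \<phi> \<Longrightarrow> \<phi> \<in> borel_measurable rep"
  using borel_measurable_continuous_on_restrict measurable_cong_sets[OF sets_rep refl] by blast

lemma integrable_rep:
  fixes \<phi> :: "'b \<Rightarrow> real"
  assumes "continuous_on K \<phi>" shows "integrable rep \<phi>"
proof -
  obtain B where "\<And>x. x \<in> K \<Longrightarrow> \<bar>\<phi> x\<bar> \<le> B"
    using compact_continuous_bounded[OF compact assms] by blast
  then show ?thesis
    by (intro rep.integrable_const_bound[of _ B] measurable_rep assms AE_I2) (auto simp: space_rep)
qed

text \<open>Layer-cake argument: \<open>\<phi>\<close> is the sum of slices \<open>c j\<close>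
  between the heights \<open>j / N\<close> and \<open>(j + 1) / N\<close>. Since
  \<open>N * c j\<close> is at most 1 and vanishes off the level set \<open>A j\<close>,
  \<open>outer_ge\<close> bounds \<open>L (c j)\<close> by the measure of \<open>A j\<close> divided
  by \<open>N\<close>. The resulting step function exceeds \<open>\<phi>\<close> by at most
  \<open>1 / N\<close>, and \<open>N\<close> tends to infinity.\<close>

lemma L_le_integral:
  assumes \<phi>: "continuous_on K \<phi>" and 01: "\<And>x. x \<in> K \<Longrightarrow> 0 \<le> \<phi> x" "\<And>x. x \<in> K \<Longrightarrow> \<phi> x \<le> 1"
  shows "L \<phi> \<le> integral\<^sup>L rep \<phi>"
proof -
  have bound: "L \<phi> \<le> integral\<^sup>L rep \<phi> + (1 / real N) * measure rep K" if "N > 0" for N :: nat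
  proof -
    define A where "A = (\<lambda>j::nat. {x \<in> K. j / N < \<phi> x})"
    have A: "A j \<in> sets rep" for j
      using borel_measurable_less[OF borel_measurable_const measurable_rep[OF \<phi>]]
      by (simp add: A_def space_rep)
    define c where "c = (\<lambda>j x. min (Suc j / N) (\<phi> x) - min (j / N) (\<phi> x))"
    have contc: "continuous_on K (c j)" for j
      unfolding c_def by (intro continuous_intros \<phi>)
    have Lc: "L (c j) \<le> (1 / N) * measure rep (A j)" for j
    proof -
      have "ennreal (L (\<lambda>x. N * c j x)) \<le> outer (A j)"
      proof (rule outer_ge)
        show "continuous_on K (\<lambda>x. real N * c j x)" by (intro continuous_intros contc)
        fix x
        have "c j x \<le> 1 / N" using that by (auto simp: c_def min_def field_simps)
        then show "real N * c j x \<le> 1" using that by (simp add: field_simps)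
      next
        fix x assume "x \<in> K - A j"
        then have "\<phi> x \<le> j / N" by (auto simp: A_def)
        moreover have "real j / N \<le> Suc j / N" by (simp add: divide_right_mono)
        ultimately have "c j x = 0" by (simp add: c_def min_def)
        then show "real N * c j x \<le> 0" by simp
      qed
      also have "outer (A j) = ennreal (measure rep (A j))"
        using emeasure_rep A[of j] rep.emeasure_eq_measure sets_rep by metis
      finally have "N * L (c j) \<le> measure rep (A j)"
        by (simp add: ennreal_le_iff L_scale contc)
      then show ?thesis using that by (simp add: field_simps)
    qed
    have sumc: "(\<Sum>j<N. c j x) = \<phi> x" if "x \<in> K" for x
      using sum_lessThan_telescope[of "\<lambda>j. min (real j / N) (\<phi> x)" N] 01[OF that] \<open>N > 0\<close>
      by (simp add: c_def)
    \<comment> \<open>The bound \<open>n / N\<close> carries the induction: on \<open>A n\<close>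
      the previous sum is at most \<open>n / N < \<phi> x\<close>, so adding \<open>1 / N\<close>
      stays below \<open>\<phi> x + 1 / N\<close>.\<close>
    have steps: "(\<Sum>j<n. (1 / N) * indicator (A j) x) \<le> min (real n / N) (\<phi> x + 1 / N)" if "x \<in> K" for n x
    proof (induction n)
      case 0 then show ?case using 01(1)[OF that] by simp
    next
      case (Suc n)
      then show ?case using that
        by (cases "n / N < \<phi> x") (auto simp: A_def min_def add_divide_distrib split: if_splits)
    qed
    have "L \<phi> \<le> L (\<lambda>x. \<Sum>j<N. c j x)"
      by (intro L_mono \<phi> continuous_on_sum contc) (simp add: sumc)
    also have "\<dots> = (\<Sum>j<N. L (c j))" by (intro L_sum contc)
    also have "\<dots> \<le> (\<Sum>j<N. (1 / N) * measure rep (A j))" by (intro sum_mono Lc)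
    also have "\<dots> = (\<integral>x. (\<Sum>j<N. (1 / N) * indicator (A j) x) \<partial>rep)"
      using A by (simp add: Bochner_Integration.integral_sum rep.emeasure_finite less_top[symmetric])
    also have "\<dots> \<le> (\<integral>x. \<phi> x + 1 / N \<partial>rep)"
      using A steps[of _ N] by (intro integral_mono) (auto simp: space_rep integrable_rep \<phi>
          rep.emeasure_finite less_top[symmetric])
    also have "\<dots> = integral\<^sup>L rep \<phi> + (1 / N) * measure rep K"
      by (simp add: integrable_rep \<phi> space_rep)
    finally show ?thesis .
  qed
  show ?thesis
  proof (rule LIMSEQ_le_const)
    show "(\<lambda>n. integral\<^sup>L rep \<phi> + (1 / real n) * measure rep K) \<longlonglongrightarrow> integral\<^sup>L rep \<phi>"
      using tendsto_add[OF tendsto_const tendsto_mult_left_zero[OF lim_1_over_n]] by fastforce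
    show "\<exists>N. \<forall>n\<ge>N. L \<phi> \<le> integral\<^sup>L rep \<phi> + (1 / real n) * measure rep K"
      using bound by (intro exI[of _ 1]) auto
  qed
qed

text \<open>\<open>L_le_integral\<close> is one-sided; applied to \<open>1 - \<phi>\<close> as well,
  it gives the reverse inequality, because the total mass is at most \<open>L 1\<close>.\<close>

lemma integral_rep_unit:
  assumes \<phi>: "continuous_on K \<phi>" and 01: "\<And>x. x \<in> K \<Longrightarrow> 0 \<le> \<phi> x" "\<And>x. x \<in> K \<Longrightarrow> \<phi> x \<le> 1"
  shows "integral\<^sup>L rep \<phi> = L \<phi>"
proof (rule antisym[OF _ L_le_integral[OF assms]])
  have "0 \<le> L (\<lambda>x. 1)" by (intro nonneg) auto
  then have K: "measure rep K \<le> L (\<lambda>x. 1)"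
    using emeasure_rep_space by (simp add: space_rep rep.emeasure_eq_measure ennreal_le_iff)
  have "L (\<lambda>x. 1 - \<phi> x) \<le> (\<integral>x. 1 - \<phi> x \<partial>rep)"
    using 01 by (intro L_le_integral continuous_intros \<phi>) auto
  then have "L (\<lambda>x. 1) - L \<phi> \<le> measure rep K - integral\<^sup>L rep \<phi>"
    by (simp add: L_diff \<phi> integrable_rep space_rep)
  with K show "integral\<^sup>L rep \<phi> \<le> L \<phi>" by linarith
qed

lemma integral_rep:
  assumes \<phi>: "continuous_on K \<phi>"
  shows "integral\<^sup>L rep \<phi> = L \<phi>"
proof -
  obtain B where B: "B > 0" "\<And>x. x \<in> K \<Longrightarrow> \<bar>\<phi> x\<bar> \<le> B"
    using compact_continuous_bounded[OF compact \<phi>] by blast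
  \<comment> \<open>Affine rescaling of the range \<open>[-B, B]\<close> to
    \<open>[0, 1]\<close>.\<close>
  define \<psi> where "\<psi> = (\<lambda>x. (\<phi> x + B) / (2 * B))"
  have cont: "continuous_on K \<psi>"
    unfolding \<psi>_def using B(1) by (intro continuous_intros \<phi>) auto
  have "0 \<le> \<psi> x \<and> \<psi> x \<le> 1" if "x \<in> K" for x
    using B(1) B(2)[OF that] by (auto simp: \<psi>_def field_simps)
  then have "integral\<^sup>L rep \<psi> = L \<psi>" by (intro integral_rep_unit cont) auto
  moreover have "integral\<^sup>L rep (\<lambda>x. 1) = L (\<lambda>x. 1)" by (intro integral_rep_unit) auto
  moreover have "\<phi> = (\<lambda>x. (2 * B) * \<psi> x - B * 1)" using B(1) by (auto simp: \<psi>_def)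
  moreover have "L (\<lambda>x. (2 * B) * \<psi> x - B * 1) = (2 * B) * L \<psi> - B * L (\<lambda>x. 1)"
    using L_diff[of "\<lambda>x. (2 * B) * \<psi> x" "\<lambda>x. B * 1"] L_scale[OF cont, of "2 * B"] L_scale[of "\<lambda>x. 1" B] cont
    by (simp add: continuous_on_mult_left)
  moreover have "(\<integral>x. (2 * B) * \<psi> x - B * 1 \<partial>rep) = (2 * B) * integral\<^sup>L rep \<psi> - B * (\<integral>x. 1 \<partial>rep)"
    using integrable_rep[OF cont] by (subst Bochner_Integration.integral_diff) auto
  ultimately show ?thesis by metis
qed

end

theorem Riesz_representation_compact:
  fixes K :: "'b::metric_space set"
  assumes "compact K" "linear_functional_on {\<phi>. continuous_on K \<phi>} L"
    and "\<And>\<phi>. continuous_on K \<phi> \<Longrightarrow> (\<And>x. x \<in> K \<Longrightarrow> 0 \<le> \<phi> x) \<Longrightarrow> 0 \<le> L \<phi>"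
  obtains M where "sets M = sets (restrict_space borel K)" "finite_measure M"
    "\<And>\<phi>. continuous_on K \<phi> \<Longrightarrow> integral\<^sup>L M \<phi> = L \<phi>"
proof -
  interpret positive_functional K L by (rule positive_functional.intro; fact)
  show ?thesis by (rule that[OF sets_rep rep.finite_measure_axioms integral_rep])
qed

subsection \<open>Invariant functionals\<close>

lemma fun_subspace_continuous: "fun_subspace {\<phi> :: 'b::topological_space \<Rightarrow> real. continuous_on W \<phi>}"
  by (auto simp: fun_subspace_def intro: continuous_intros)

text \<open>Telescoping the coboundary \<open>\<psi> - \<psi> \<circ> T\<close> along an orbit of length \<open>n\<close> keeps it bounded,
  so it does not contribute after division by \<open>n\<close>.\<close>

lemma coboundary_lower_bound:
  fixes p :: "('c::metric_space \<Rightarrow> real) \<Rightarrow> real"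
  assumes W: "compact W" and T: "continuous_on W T" "T ` W \<subseteq> W"
    and p: "sublinear_on {\<phi>. continuous_on W \<phi>} p"
    and mono: "\<And>\<phi> \<psi>. continuous_on W \<phi> \<Longrightarrow> continuous_on W \<psi> \<Longrightarrow> (\<And>x. x \<in> W \<Longrightarrow> \<phi> x \<le> \<psi> x) \<Longrightarrow> p \<phi> \<le> p \<psi>"
    and sub: "\<And>\<phi>. continuous_on W \<phi> \<Longrightarrow> p (\<lambda>x. \<phi> (T x)) \<le> p \<phi>"
    and \<psi>: "continuous_on W \<psi>"
  shows "p (\<lambda>x. c) \<le> p (\<lambda>x. c + (\<psi> x - \<psi> (T x)))"
proof -
  note padd = sublinear_on_add[OF p, simplified] and pscale = sublinear_on_scale[OF p, simplified]
  have TW: "(T ^^ n) x \<in> W" if "x \<in> W" for n x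
    using that T(2) by (induction n) auto
  have contT: "continuous_on W (\<lambda>x. \<phi> ((T ^^ n) x))" if "continuous_on W \<phi>" for \<phi> :: "'c \<Rightarrow> real" and n
  proof (induction n)
    case (Suc n)
    have "continuous_on W (\<lambda>x. \<phi> ((T ^^ n) (T x)))"
      by (rule continuous_on_compose2[OF Suc T])
    then show ?case by (simp add: funpow_swap1)
  qed (simp add: that)
  have subn: "p (\<lambda>x. \<phi> ((T ^^ n) x)) \<le> p \<phi>" if "continuous_on W \<phi>" for \<phi> n
  proof (induction n)
    case (Suc n)
    have "p (\<lambda>x. \<phi> ((T ^^ n) (T x))) \<le> p (\<lambda>x. \<phi> ((T ^^ n) x))"
      by (rule sub[OF contT[OF that]])
    with Suc show ?case by (simp add: funpow_swap1)
  qed simp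
  define g where "g = (\<lambda>x. c + (\<psi> x - \<psi> (T x)))"
  have contg: "continuous_on W g"
    using contT[OF \<psi>, of 1] unfolding g_def by (intro continuous_intros \<psi>) simp
  \<comment> \<open>The function on the left is the sum of \<open>g ((T ^^ k) x)\<close> over
    \<open>k < n\<close>, and by \<open>subn\<close> each summand has \<open>p\<close>-value at most
    \<open>p g\<close>.\<close>
  have tele: "p (\<lambda>x. real n * c + (\<psi> x - \<psi> ((T ^^ n) x))) \<le> real n * p g" for n
  proof (induction n)
    case 0
    then show ?case using pscale[of "\<lambda>x. 0" 0] by simp
  next
    case (Suc n)
    have "(\<lambda>x. real (Suc n) * c + (\<psi> x - \<psi> ((T ^^ Suc n) x)))
        = (\<lambda>x. (real n * c + (\<psi> x - \<psi> ((T ^^ n) x))) + g ((T ^^ n) x))"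
      by (auto simp: g_def algebra_simps)
    then have "p (\<lambda>x. real (Suc n) * c + (\<psi> x - \<psi> ((T ^^ Suc n) x)))
        \<le> p (\<lambda>x. real n * c + (\<psi> x - \<psi> ((T ^^ n) x))) + p (\<lambda>x. g ((T ^^ n) x))"
      by (simp only:) (intro padd continuous_intros \<psi> contT contg)
    with Suc subn[OF contg, of n] show ?case by (simp add: algebra_simps)
  qed
  obtain B where B: "B > 0" "\<And>x. x \<in> W \<Longrightarrow> \<bar>\<psi> x\<bar> \<le> B"
    using compact_continuous_bounded[OF W \<psi>] by blast
  have "real n * (p (\<lambda>x. c) - p g) \<le> 2 * B * p (\<lambda>x. 1)" for n
  proof -
    have "real n * p (\<lambda>x. c) = p (\<lambda>x. real n * c)" using pscale[of "\<lambda>x. c" "real n"] by simp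
    also have "(\<lambda>x. real n * c) = (\<lambda>x. (real n * c + (\<psi> x - \<psi> ((T ^^ n) x))) + (\<psi> ((T ^^ n) x) - \<psi> x))"
      by auto
    also have "p \<dots> \<le> p (\<lambda>x. real n * c + (\<psi> x - \<psi> ((T ^^ n) x))) + p (\<lambda>x. \<psi> ((T ^^ n) x) - \<psi> x)"
      by (intro padd continuous_intros \<psi> contT)
    also have "p (\<lambda>x. \<psi> ((T ^^ n) x) - \<psi> x) \<le> p (\<lambda>x. (2 * B) * 1)"
    proof (intro mono continuous_intros \<psi> contT)
      fix x assume "x \<in> W"
      then show "\<psi> ((T ^^ n) x) - \<psi> x \<le> (2 * B) * 1"
        using B(2)[of x] B(2)[OF TW, of x n] by simp
    qed
    also have "p (\<lambda>x. (2 * B) * 1) = 2 * B * p (\<lambda>x. 1)"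
      using pscale[of "\<lambda>x. 1" "2 * B"] B(1) by simp
    finally show ?thesis using tele[of n] by (simp add: algebra_simps)
  qed
  then have "p (\<lambda>x. c) - p g \<le> 0"
    by (meson ex_less_of_nat_mult linorder_not_less)
  then show ?thesis by (simp add: g_def)
qed

text \<open>A Krylov-Bogolyubov theorem with Hahn-Banach in place of limits of orbit averages.
  Extending from the constant 1 yields \<open>L 1 = q 1\<close>, and
  \<open>coboundary_lower_bound\<close> says that passing from \<open>p\<close> to \<open>q\<close>
  loses nothing on constants.\<close>

theorem exists_invariant_functional:
  fixes p :: "('c::metric_space \<Rightarrow> real) \<Rightarrow> real"
  assumes W: "compact W" and T: "continuous_on W T" "T ` W \<subseteq> W"
    and p: "sublinear_on {\<phi>. continuous_on W \<phi>} p"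
    and mono: "\<And>\<phi> \<psi>. continuous_on W \<phi> \<Longrightarrow> continuous_on W \<psi> \<Longrightarrow> (\<And>x. x \<in> W \<Longrightarrow> \<phi> x \<le> \<psi> x) \<Longrightarrow> p \<phi> \<le> p \<psi>"
    and sub: "\<And>\<phi>. continuous_on W \<phi> \<Longrightarrow> p (\<lambda>x. \<phi> (T x)) \<le> p \<phi>"
  obtains L where "linear_functional_on {\<phi>. continuous_on W \<phi>} L"
    "\<And>\<phi>. continuous_on W \<phi> \<Longrightarrow> L \<phi> \<le> p \<phi>" "L (\<lambda>x. 1) = p (\<lambda>x. 1)"
    "\<And>\<phi>. continuous_on W \<phi> \<Longrightarrow> L (\<lambda>x. \<phi> (T x)) = L \<phi>"
proof -
  note padd = sublinear_on_add[OF p, simplified] and pscale = sublinear_on_scale[OF p, simplified]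
  have lower: "p (\<lambda>x. c) \<le> p (\<lambda>x. c + (\<psi> x - \<psi> (T x)))" if "continuous_on W \<psi>" for c \<psi>
    by (rule coboundary_lower_bound[OF W T p]; fact)
  have contT: "continuous_on W (\<lambda>x. \<phi> (T x))" if "continuous_on W \<phi>" for \<phi> :: "'c \<Rightarrow> real"
    by (rule continuous_on_compose2[OF that T])
  have p0: "p (\<lambda>x. 0) = 0" using pscale[of "\<lambda>x. 0" 0] by simp
  define S where "S = (\<lambda>\<phi>. {p (\<lambda>x. \<phi> x + (\<psi> x - \<psi> (T x))) | \<psi>. continuous_on W \<psi>})"
  define q where "q = (\<lambda>\<phi>. Inf (S \<phi>))"
  have SI: "p (\<lambda>x. \<phi> x + (\<psi> x - \<psi> (T x))) \<in> S \<phi>" if "continuous_on W \<psi>" for \<phi> \<psi>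
    using that by (auto simp: S_def)
  have S0: "p \<phi> \<in> S \<phi>" for \<phi> using SI[of "\<lambda>x. 0" \<phi>] by simp
  have bdd: "bdd_below (S \<phi>)" if \<phi>: "continuous_on W \<phi>" for \<phi>
  proof (rule bdd_belowI)
    fix a assume "a \<in> S \<phi>"
    then obtain \<psi> where \<psi>: "continuous_on W \<psi>" and a: "a = p (\<lambda>x. \<phi> x + (\<psi> x - \<psi> (T x)))"
      by (auto simp: S_def)
    \<comment> \<open>The case \<open>c = 0\<close> of \<open>lower\<close>: a coboundary has
      non-negative \<open>p\<close>-value, and subadditivity separates off
      \<open>- \<phi>\<close>.\<close>
    have "0 \<le> p (\<lambda>x. (\<phi> x + (\<psi> x - \<psi> (T x))) + - \<phi> x)"
      using lower[OF \<psi>, of 0] p0 by simp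
    also have "\<dots> \<le> a + p (\<lambda>x. - \<phi> x)"
      unfolding a by (intro padd continuous_intros \<phi> \<psi> contT)
    finally show "- p (\<lambda>x. - \<phi> x) \<le> a" by simp
  qed
  have qle: "q \<phi> \<le> p (\<lambda>x. \<phi> x + (\<psi> x - \<psi> (T x)))" if "continuous_on W \<phi>" "continuous_on W \<psi>" for \<phi> \<psi>
    unfolding q_def using SI[OF that(2)] bdd[OF that(1)] by (rule cInf_lower)
  have qconst: "q (\<lambda>x. c) = p (\<lambda>x. c)" for c
    unfolding q_def using S0 lower by (intro cInf_eq_minimum) (auto simp: S_def)
  have "sublinear_on {\<phi>. continuous_on W \<phi>} q"
    unfolding q_def
  proof (rule sublinear_on_Inf[OF fun_subspace_continuous])
    fix \<phi> \<phi>' a b assume \<phi>: "\<phi> \<in> {\<phi>. continuous_on W \<phi>}" "\<phi>' \<in> {\<phi>. continuous_on W \<phi>}"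
      and "a \<in> S \<phi>" "b \<in> S \<phi>'"
    then obtain \<psi> \<psi>' where \<psi>: "continuous_on W \<psi>" "continuous_on W \<psi>'"
      and a: "a = p (\<lambda>x. \<phi> x + (\<psi> x - \<psi> (T x)))" and b: "b = p (\<lambda>x. \<phi>' x + (\<psi>' x - \<psi>' (T x)))"
      by (auto simp: S_def)
    have "p (\<lambda>x. (\<phi> x + (\<psi> x - \<psi> (T x))) + (\<phi>' x + (\<psi>' x - \<psi>' (T x)))) \<le> a + b"
      unfolding a b using \<phi> by (intro padd continuous_intros \<psi> contT) auto
    moreover have "(\<lambda>x. (\<phi> x + (\<psi> x - \<psi> (T x))) + (\<phi>' x + (\<psi>' x - \<psi>' (T x))))
        = (\<lambda>x. (\<phi> x + \<phi>' x) + ((\<psi> x + \<psi>' x) - (\<psi> (T x) + \<psi>' (T x))))"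
      by (auto simp: algebra_simps)
    moreover have "p (\<lambda>x. (\<phi> x + \<phi>' x) + ((\<psi> x + \<psi>' x) - (\<psi> (T x) + \<psi>' (T x)))) \<in> S (\<lambda>x. \<phi> x + \<phi>' x)"
      using SI[OF continuous_on_add[OF \<psi>]] by simp
    ultimately show "\<exists>c\<in>S (\<lambda>x. \<phi> x + \<phi>' x). c \<le> a + b"
      by (intro bexI) simp_all
  next
    fix \<phi> a and t :: real assume \<phi>: "\<phi> \<in> {\<phi>. continuous_on W \<phi>}" and t: "t > 0" and "a \<in> S \<phi>"
    then obtain \<psi> where \<psi>: "continuous_on W \<psi>" and a: "a = p (\<lambda>x. \<phi> x + (\<psi> x - \<psi> (T x)))"
      by (auto simp: S_def)
    have "p (\<lambda>x. t * (\<phi> x + (\<psi> x - \<psi> (T x)))) = t * a"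
      unfolding a using \<phi> t by (intro pscale continuous_intros \<psi> contT) auto
    moreover have "p (\<lambda>x. t * \<phi> x + (t * \<psi> x - t * \<psi> (T x))) \<in> S (\<lambda>x. t * \<phi> x)"
      using SI[OF continuous_on_mult_left[OF \<psi>, of t]] by simp
    ultimately show "\<exists>c\<in>S (\<lambda>x. t * \<phi> x). c \<le> t * a"
      by (intro bexI) (auto simp: algebra_simps)
  next
    show "Inf (S (\<lambda>x. 0)) = 0" using qconst[of 0] p0 by (simp add: q_def)
  qed (use S0 bdd in auto)
  then obtain L where L: "linear_functional_on {\<phi>. continuous_on W \<phi>} L"
    and Lq: "\<And>\<phi>. continuous_on W \<phi> \<Longrightarrow> L \<phi> \<le> q \<phi>" and L1: "L (\<lambda>x. 1) = q (\<lambda>x. 1)"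
    using Hahn_Banach_functions[OF fun_subspace_continuous, of W q "\<lambda>x. 1"] by auto
  have Ladd: "L (\<lambda>x. \<phi> x + \<psi> x) = L \<phi> + L \<psi>" and Lscale: "L (\<lambda>x. c * \<phi> x) = c * L \<phi>"
    if "continuous_on W \<phi>" "continuous_on W \<psi>" for c \<phi> \<psi>
    using L that by (auto simp: linear_functional_on_def)
  have inv: "L \<phi> \<le> L (\<lambda>x. \<phi> (T x))" if \<phi>: "continuous_on W \<phi>" for \<phi>
  proof -
    have "L \<phi> - L (\<lambda>x. \<phi> (T x)) = L (\<lambda>x. \<phi> x + -1 * \<phi> (T x))"
      using Ladd[of \<phi> "\<lambda>x. -1 * \<phi> (T x)"] Lscale[of "\<lambda>x. \<phi> (T x)" "\<lambda>x. \<phi> (T x)" "-1"] \<phi> contT[OF \<phi>]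
      by (simp add: continuous_on_minus)
    also have "\<dots> \<le> q (\<lambda>x. \<phi> x + -1 * \<phi> (T x))"
      by (intro Lq continuous_intros \<phi> contT)
    \<comment> \<open>The choice \<open>\<psi> = - \<phi>\<close> cancels the argument completely,
      leaving \<open>p 0 = 0\<close>.\<close>
    also have "\<dots> \<le> p (\<lambda>x. (\<phi> x + -1 * \<phi> (T x)) + (- \<phi> x - - \<phi> (T x)))"
      by (intro qle continuous_intros \<phi> contT)
    finally show ?thesis using p0 by simp
  qed
  show ?thesis
  proof (rule that[OF L])
    show "L \<phi> \<le> p \<phi>" if "continuous_on W \<phi>" for \<phi>
      using Lq[OF that] qle[OF that, of "\<lambda>x. 0"] by simp
    show "L (\<lambda>x. 1) = p (\<lambda>x. 1)" using L1 qconst by simp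
    fix \<phi> :: "'c \<Rightarrow> real" assume \<phi>: "continuous_on W \<phi>"
    have "L (\<lambda>x. -1 * \<phi> x) \<le> L (\<lambda>x. -1 * \<phi> (T x))"
      by (rule inv) (intro continuous_intros \<phi>)
    then have "L (\<lambda>x. \<phi> (T x)) \<le> L \<phi>"
      using Lscale[OF \<phi> \<phi>, of "-1"] Lscale[OF contT[OF \<phi>] \<phi>, of "-1"] by simp
    with inv[OF \<phi>] show "L (\<lambda>x. \<phi> (T x)) = L \<phi>" by simp
  qed
qed

subsection \<open>Positive strong submeasures\<close>

lemma SMposD:
  assumes "SMpos W \<mu>"
  shows SMpos_add: "continuous_on W \<phi> \<Longrightarrow> continuous_on W \<psi> \<Longrightarrow> \<mu> (\<lambda>x. \<phi> x + \<psi> x) \<le> \<mu> \<phi> + \<mu> \<psi>"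
    and SMpos_scale: "continuous_on W \<phi> \<Longrightarrow> c \<ge> 0 \<Longrightarrow> \<mu> (\<lambda>x. c * \<phi> x) = c * \<mu> \<phi>"
    and SMpos_mono: "continuous_on W \<phi> \<Longrightarrow> continuous_on W \<psi> \<Longrightarrow> (\<And>x. x \<in> W \<Longrightarrow> \<phi> x \<le> \<psi> x) \<Longrightarrow> \<mu> \<phi> \<le> \<mu> \<psi>"
    and SMpos_bounded: "\<exists>C. \<forall>\<phi>. continuous_on W \<phi> \<longrightarrow> \<bar>\<mu> \<phi>\<bar> \<le> C * sup_norm W \<phi>"
  using assms unfolding SMpos_def by blast+

lemma SMpos_zero: "SMpos W \<mu> \<Longrightarrow> \<mu> (\<lambda>x. 0) = 0"
  using SMpos_scale[of W \<mu> "\<lambda>x. 0" 0] by simp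

lemma SMpos_unit_nonneg: "SMpos W \<mu> \<Longrightarrow> 0 \<le> \<mu> (\<lambda>x. 1)"
  using SMpos_mono[of W \<mu> "\<lambda>x. 0" "\<lambda>x. 1"] SMpos_zero[of W \<mu>] by simp

lemma abs_le_sup_norm:
  fixes W :: "'b::metric_space set"
  assumes "compact W" "continuous_on W \<phi>" "x \<in> W"
  shows "\<bar>\<phi> x\<bar> \<le> sup_norm W \<phi>"
proof -
  obtain B where "\<And>x. x \<in> W \<Longrightarrow> \<bar>\<phi> x\<bar> \<le> B"
    using compact_continuous_bounded[OF assms(1,2)] by blast
  then have "bdd_above ((\<lambda>x. \<bar>\<phi> x\<bar>) ` W)" by (intro bdd_aboveI2)
  then show ?thesis using assms(3) by (auto simp: sup_norm_def intro: cSUP_upper)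
qed

text \<open>Squeezing \<open>\<phi>\<close> between the constants given by its sup norm shows that
  \<open>\<mu> 1\<close> is an admissible bound, so a submeasure vanishing at 1 vanishes on all
  continuous functions.\<close>

lemma SMpos_abs_le:
  fixes W :: "'b::metric_space set"
  assumes W: "compact W" and \<mu>: "SMpos W \<mu>" and \<phi>: "continuous_on W \<phi>"
  shows "\<bar>\<mu> \<phi>\<bar> \<le> \<mu> (\<lambda>x. 1) * sup_norm W \<phi>"
proof (cases "W = {}")
  case True
  \<comment> \<open>On the empty space \<open>sup_norm\<close> is 0 by definition, so boundedness
    forces \<open>\<mu> \<phi> = 0\<close>.\<close>
  with SMpos_bounded[OF \<mu>] \<phi> show ?thesis by (auto simp: sup_norm_def)
next
  case False
  let ?S = "sup_norm W \<phi>"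
  have S: "\<bar>\<phi> x\<bar> \<le> ?S" if "x \<in> W" for x by (rule abs_le_sup_norm[OF W \<phi> that])
  with False have "0 \<le> ?S" by (meson abs_ge_zero ex_in_conv order_trans)
  then have c: "\<mu> (\<lambda>x. ?S * 1) = ?S * \<mu> (\<lambda>x. 1)"
    by (intro SMpos_scale[OF \<mu>]) auto
  have "\<mu> \<phi> \<le> \<mu> (\<lambda>x. ?S * 1)" "\<mu> (\<lambda>x. - \<phi> x) \<le> \<mu> (\<lambda>x. ?S * 1)"
    using S by (intro SMpos_mono[OF \<mu>] continuous_intros \<phi>; force)+
  \<comment> \<open>A submeasure need not be odd; its lower bound comes from the upper bound at
    \<open>- \<phi>\<close>.\<close>
  moreover have "0 \<le> \<mu> \<phi> + \<mu> (\<lambda>x. - \<phi> x)"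
    using SMpos_add[OF \<mu> \<phi> continuous_on_minus[OF \<phi>]] SMpos_zero[OF \<mu>] by simp
  ultimately show ?thesis unfolding c by (simp add: abs_le_iff mult.commute)
qed

lemma sm_norm_eq:
  fixes W :: "'b::metric_space set"
  assumes W: "compact W" "W \<noteq> {}" and \<mu>: "SMpos W \<mu>"
  shows "sm_norm W \<mu> = \<mu> (\<lambda>x. 1)"
  unfolding sm_norm_def
proof (rule cInf_eq_minimum)
  show "\<mu> (\<lambda>x. 1) \<in> {C. C \<ge> 0 \<and> (\<forall>\<phi>. continuous_on W \<phi> \<longrightarrow> \<bar>\<mu> \<phi>\<bar> \<le> C * sup_norm W \<phi>)}"
    using SMpos_abs_le[OF W(1) \<mu>] SMpos_unit_nonneg[OF \<mu>] by auto
  fix C assume "C \<in> {C. C \<ge> 0 \<and> (\<forall>\<phi>. continuous_on W \<phi> \<longrightarrow> \<bar>\<mu> \<phi>\<bar> \<le> C * sup_norm W \<phi>)}"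
  then have "\<bar>\<mu> (\<lambda>x. 1)\<bar> \<le> C * sup_norm W (\<lambda>x. 1)" by auto
  then show "\<mu> (\<lambda>x. 1) \<le> C" using W(2) by (simp add: sup_norm_def)
qed

lemma SMpos_positive_linear:
  fixes W :: "'b::metric_space set"
  assumes W: "compact W" and L: "linear_functional_on {\<phi>. continuous_on W \<phi>} L"
    and nonneg: "\<And>\<phi>. continuous_on W \<phi> \<Longrightarrow> (\<And>x. x \<in> W \<Longrightarrow> 0 \<le> \<phi> x) \<Longrightarrow> 0 \<le> L \<phi>"
  shows "SMpos W L"
proof -
  interpret positive_functional W L by (rule positive_functional.intro; fact)
  have "\<bar>L \<phi>\<bar> \<le> L (\<lambda>x. 1) * sup_norm W \<phi>" if \<phi>: "continuous_on W \<phi>" for \<phi>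
  proof -
    let ?S = "sup_norm W \<phi>"
    have "\<phi> x \<le> ?S * 1 \<and> - \<phi> x \<le> ?S * 1" if "x \<in> W" for x
      using abs_le_sup_norm[OF W \<phi> that] by (auto simp: abs_le_iff)
    then have "L \<phi> \<le> L (\<lambda>x. ?S * 1)" "L (\<lambda>x. -1 * \<phi> x) \<le> L (\<lambda>x. ?S * 1)"
      by (intro L_mono continuous_intros \<phi>; simp)+
    then show ?thesis using L_scale[OF \<phi>, of "-1"] L_scale[of "\<lambda>x. 1" ?S] by (simp add: abs_le_iff mult.commute)
  qed
  then have "\<exists>C. \<forall>\<phi>. continuous_on W \<phi> \<longrightarrow> \<bar>L \<phi>\<bar> \<le> C * sup_norm W \<phi>" by blast
  then show ?thesis
    unfolding SMpos_def by (simp add: L_add L_scale L_mono)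
qed

text \<open>A common bound on the values at 1 bounds the whole family on each continuous function,
  so the suprema are finite; sublinearity and monotonicity survive pointwise suprema.\<close>

lemma SMpos_SUP:
  fixes W :: "'b::metric_space set"
  assumes W: "compact W" and "I \<noteq> {}" and I: "\<And>\<nu>. \<nu> \<in> I \<Longrightarrow> SMpos W \<nu>"
    and C: "\<And>\<nu>. \<nu> \<in> I \<Longrightarrow> \<nu> (\<lambda>x. 1) \<le> C"
  shows "SMpos W (\<lambda>\<phi>. SUP \<nu>\<in>I. \<nu> \<phi>)"
    and "\<And>\<nu> \<phi>. \<nu> \<in> I \<Longrightarrow> continuous_on W \<phi> \<Longrightarrow> \<nu> \<phi> \<le> (SUP \<nu>\<in>I. \<nu> \<phi>)"
proof -
  have bound: "\<bar>\<nu> \<phi>\<bar> \<le> C * sup_norm W \<phi>" if "\<nu> \<in> I" "continuous_on W \<phi>" for \<nu> \<phi>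
  proof -
    have "0 \<le> sup_norm W \<phi>"
    proof (cases "W = {}")
      case False
      then show ?thesis using abs_le_sup_norm[OF W that(2)] by (meson abs_ge_zero ex_in_conv order_trans)
    qed (simp add: sup_norm_def)
    with SMpos_abs_le[OF W I[OF that(1)] that(2)] mult_right_mono[OF C[OF that(1)]]
    show ?thesis by force
  qed
  have bdd: "bdd_above ((\<lambda>\<nu>. \<nu> \<phi>) ` I)" if "continuous_on W \<phi>" for \<phi>
    using bound[OF _ that] by (intro bdd_aboveI2[where M = "C * sup_norm W \<phi>"]) (auto simp: abs_le_iff)
  show upper: "\<nu> \<phi> \<le> (SUP \<nu>\<in>I. \<nu> \<phi>)" if "\<nu> \<in> I" "continuous_on W \<phi>" for \<nu> \<phi>
    using that bdd by (intro cSUP_upper) auto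
  show "SMpos W (\<lambda>\<phi>. SUP \<nu>\<in>I. \<nu> \<phi>)"
    unfolding SMpos_def
  proof (intro conjI allI impI exI)
    fix \<phi> \<psi> :: "'b \<Rightarrow> real" assume \<phi>: "continuous_on W \<phi>" and \<psi>: "continuous_on W \<psi>"
    have "\<nu> (\<lambda>x. \<phi> x + \<psi> x) \<le> (SUP \<nu>\<in>I. \<nu> \<phi>) + (SUP \<nu>\<in>I. \<nu> \<psi>)" if "\<nu> \<in> I" for \<nu>
      using SMpos_add[OF I[OF that] \<phi> \<psi>] upper[OF that \<phi>] upper[OF that \<psi>] by linarith
    then show "(SUP \<nu>\<in>I. \<nu> (\<lambda>x. \<phi> x + \<psi> x)) \<le> (SUP \<nu>\<in>I. \<nu> \<phi>) + (SUP \<nu>\<in>I. \<nu> \<psi>)"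
      using \<open>I \<noteq> {}\<close> by (intro cSUP_least)
  next
    fix c :: real and \<phi> :: "'b \<Rightarrow> real" assume c: "c \<ge> 0" and \<phi>: "continuous_on W \<phi>"
    have *: "(SUP \<nu>\<in>I. \<nu> (\<lambda>x. c * \<phi> x)) = (SUP \<nu>\<in>I. c * \<nu> \<phi>)"
      using SMpos_scale[OF I \<phi> c] by (intro SUP_cong) auto
    have "continuous (at_left z) ((*) c)" for z by (intro continuous_intros)
    then have "(SUP \<nu>\<in>I. c * \<nu> \<phi>) = c * (SUP \<nu>\<in>I. \<nu> \<phi>)"
      using continuous_at_Sup_mono[of "\<lambda>x. c * x" "(\<lambda>\<nu>. \<nu> \<phi>) ` I"] c \<open>I \<noteq> {}\<close> bdd[OF \<phi>]
      by (simp add: mono_def mult_left_mono image_image)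
    with * show "(SUP \<nu>\<in>I. \<nu> (\<lambda>x. c * \<phi> x)) = c * (SUP \<nu>\<in>I. \<nu> \<phi>)" by simp
  next
    fix \<phi> :: "'b \<Rightarrow> real" assume \<phi>: "continuous_on W \<phi>"
    obtain \<nu> where \<nu>: "\<nu> \<in> I" using \<open>I \<noteq> {}\<close> by blast
    have "(SUP \<nu>\<in>I. \<nu> \<phi>) \<le> C * sup_norm W \<phi>"
      using bound[OF _ \<phi>] \<open>I \<noteq> {}\<close> by (intro cSUP_least) (auto simp: abs_le_iff)
    with upper[OF \<nu> \<phi>] bound[OF \<nu> \<phi>] show "\<bar>SUP \<nu>\<in>I. \<nu> \<phi>\<bar> \<le> C * sup_norm W \<phi>" by linarith
  next
    fix \<phi> \<psi> :: "'b \<Rightarrow> real" assume \<phi>: "continuous_on W \<phi>" and \<psi>: "continuous_on W \<psi>" and le: "\<forall>x\<in>W. \<phi> x \<le> \<psi> x"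
    have "\<nu> \<phi> \<le> (SUP \<nu>\<in>I. \<nu> \<psi>)" if "\<nu> \<in> I" for \<nu>
      using SMpos_mono[OF I[OF that] \<phi> \<psi>] le upper[OF that \<psi>] by fastforce
    then show "(SUP \<nu>\<in>I. \<nu> \<phi>) \<le> (SUP \<nu>\<in>I. \<nu> \<psi>)"
      using \<open>I \<noteq> {}\<close> by (intro cSUP_least)
  qed
qed

text \<open>The largest strong submeasure on \<open>W\<close> whose push-forward under \<open>g\<close> is at most \<open>\<mu>\<close>.\<close>

definition pull :: "'b::topological_space set \<Rightarrow> 'c set \<Rightarrow> ('c \<Rightarrow> 'b) \<Rightarrow> (('b \<Rightarrow> real) \<Rightarrow> real) \<Rightarrow> ('c \<Rightarrow> real) \<Rightarrow> real" where
  "pull X W g \<mu> = (\<lambda>\<phi>. Inf {\<mu> \<psi> | \<psi>. continuous_on X \<psi> \<and> (\<forall>s\<in>W. \<phi> s \<le> \<psi> (g s))})"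

context
  fixes X :: "'b::topological_space set" and W :: "'c::metric_space set" and g :: "'c \<Rightarrow> 'b"
    and \<mu> :: "('b \<Rightarrow> real) \<Rightarrow> real"
  assumes W: "compact W" and g: "g ` W = X" and \<mu>: "SMpos X \<mu>"
begin

text \<open>Surjectivity of \<open>g\<close> turns a bound on \<open>W\<close> into a bound on all
  of \<open>X\<close>. This keeps the infimum in \<open>pull\<close> finite and fixes its value on
  constants.\<close>

lemma pull_const_le:
  assumes "continuous_on X \<psi>" "\<forall>s\<in>W. c \<le> \<psi> (g s)"
  shows "\<mu> (\<lambda>x. c) \<le> \<mu> \<psi>"
  using assms g by (intro SMpos_mono[OF \<mu>]) auto

lemma pull_nonempty:
  assumes "continuous_on W \<phi>"
  shows "{\<mu> \<psi> | \<psi>. continuous_on X \<psi> \<and> (\<forall>s\<in>W. \<phi> s \<le> \<psi> (g s))} \<noteq> {}"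
proof -
  obtain B where "\<And>x. x \<in> W \<Longrightarrow> \<bar>\<phi> x\<bar> \<le> B" using compact_continuous_bounded[OF W assms] by blast
  then have "continuous_on X (\<lambda>x. B) \<and> (\<forall>s\<in>W. \<phi> s \<le> B)" by (auto simp: abs_le_iff)
  then show ?thesis by blast
qed

lemma pull_bdd_below:
  assumes "continuous_on W \<phi>"
  shows "bdd_below {\<mu> \<psi> | \<psi>. continuous_on X \<psi> \<and> (\<forall>s\<in>W. \<phi> s \<le> \<psi> (g s))}"
proof -
  obtain B where "\<And>x. x \<in> W \<Longrightarrow> \<bar>\<phi> x\<bar> \<le> B" using compact_continuous_bounded[OF W assms] by blast
  then have B: "- B \<le> \<phi> x" if "x \<in> W" for x using that by (force simp: abs_le_iff)
  have "\<mu> (\<lambda>x. - B) \<le> \<mu> \<psi>" if "continuous_on X \<psi>" "\<forall>s\<in>W. \<phi> s \<le> \<psi> (g s)" for \<psi>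
    using that B by (intro pull_const_le) (auto intro: order_trans)
  then show ?thesis by (intro bdd_belowI[where m = "\<mu> (\<lambda>x. - B)"]) auto
qed

lemma pull_le:
  assumes "continuous_on W \<phi>" "continuous_on X \<psi>" "\<And>s. s \<in> W \<Longrightarrow> \<phi> s \<le> \<psi> (g s)"
  shows "pull X W g \<mu> \<phi> \<le> \<mu> \<psi>"
  unfolding pull_def using assms by (intro cInf_lower pull_bdd_below) auto

lemma pull_greatest:
  assumes "continuous_on W \<phi>" "\<And>\<psi>. continuous_on X \<psi> \<Longrightarrow> (\<And>s. s \<in> W \<Longrightarrow> \<phi> s \<le> \<psi> (g s)) \<Longrightarrow> a \<le> \<mu> \<psi>"
  shows "a \<le> pull X W g \<mu> \<phi>"
  unfolding pull_def using assms by (intro cInf_greatest pull_nonempty) auto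

lemma pull_mono:
  assumes "continuous_on W \<phi>" "continuous_on W \<phi>'" "\<And>x. x \<in> W \<Longrightarrow> \<phi> x \<le> \<phi>' x"
  shows "pull X W g \<mu> \<phi> \<le> pull X W g \<mu> \<phi>'"
  using assms by (intro pull_greatest pull_le) (auto intro: order_trans)

lemma pull_const: "pull X W g \<mu> (\<lambda>x. c) = \<mu> (\<lambda>x. c)"
  by (intro antisym pull_le pull_greatest pull_const_le) auto

lemma sublinear_on_pull: "sublinear_on {\<phi>. continuous_on W \<phi>} (pull X W g \<mu>)"
  unfolding pull_def
proof (rule sublinear_on_Inf[OF fun_subspace_continuous])
  fix \<phi> \<phi>' a b
  assume "a \<in> {\<mu> \<psi> | \<psi>. continuous_on X \<psi> \<and> (\<forall>s\<in>W. \<phi> s \<le> \<psi> (g s))}"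
    "b \<in> {\<mu> \<psi> | \<psi>. continuous_on X \<psi> \<and> (\<forall>s\<in>W. \<phi>' s \<le> \<psi> (g s))}"
  then obtain \<psi> \<psi>' where \<psi>: "continuous_on X \<psi>" "continuous_on X \<psi>'"
    and le: "\<forall>s\<in>W. \<phi> s \<le> \<psi> (g s)" "\<forall>s\<in>W. \<phi>' s \<le> \<psi>' (g s)" and ab: "a = \<mu> \<psi>" "b = \<mu> \<psi>'"
    by auto
  have "\<mu> (\<lambda>x. \<psi> x + \<psi>' x) \<in> {\<mu> \<psi> | \<psi>. continuous_on X \<psi> \<and> (\<forall>s\<in>W. \<phi> s + \<phi>' s \<le> \<psi> (g s))}"
    using \<psi> le by (auto intro!: exI[of _ "\<lambda>x. \<psi> x + \<psi>' x"] continuous_intros add_mono)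
  then show "\<exists>c\<in>{\<mu> \<psi> | \<psi>. continuous_on X \<psi> \<and> (\<forall>s\<in>W. \<phi> s + \<phi>' s \<le> \<psi> (g s))}. c \<le> a + b"
    using SMpos_add[OF \<mu> \<psi>] unfolding ab by blast
next
  fix \<phi> a and t :: real assume t: "t > 0"
    and "a \<in> {\<mu> \<psi> | \<psi>. continuous_on X \<psi> \<and> (\<forall>s\<in>W. \<phi> s \<le> \<psi> (g s))}"
  then obtain \<psi> where \<psi>: "continuous_on X \<psi>" and le: "\<forall>s\<in>W. \<phi> s \<le> \<psi> (g s)" and a: "a = \<mu> \<psi>"
    by auto
  have "\<mu> (\<lambda>x. t * \<psi> x) \<in> {\<mu> \<psi> | \<psi>. continuous_on X \<psi> \<and> (\<forall>s\<in>W. t * \<phi> s \<le> \<psi> (g s))}"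
    using \<psi> le t by (auto intro!: exI[of _ "\<lambda>x. t * \<psi> x"] continuous_intros)
  then show "\<exists>c\<in>{\<mu> \<psi> | \<psi>. continuous_on X \<psi> \<and> (\<forall>s\<in>W. t * \<phi> s \<le> \<psi> (g s))}. c \<le> t * a"
    using SMpos_scale[OF \<mu> \<psi>, of t] t unfolding a by fastforce
next
  show "Inf {\<mu> \<psi> | \<psi>. continuous_on X \<psi> \<and> (\<forall>s\<in>W. 0 \<le> \<psi> (g s))} = 0"
    using pull_const[of 0] SMpos_zero[OF \<mu>] by (simp add: pull_def)
qed (use pull_nonempty pull_bdd_below in auto)

end

subsection \<open>The space of orbits\<close>

lemma continuous_on_coordinate: "continuous_on S (\<lambda>s. s n)"
  by (rule continuous_on_subset[OF continuous_on_product_coordinates[of n]]) simp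

lemma continuous_on_shift: "continuous_on S shift"
  unfolding shift_def
  by (intro continuous_on_coordinatewise_then_product continuous_on_coordinate)

locale good_map =
  fixes X D :: "'a::metric_space set" and f :: "'a \<Rightarrow> 'a"
  assumes compact_X: "compact X" and map: "open_dense_map X D f" and good: "good_wrt_iterates X D f"
begin

abbreviation "\<Omega> \<equiv> Omega_inf X D f"
abbreviation "\<Gamma> \<equiv> Gamma_inf X D f"

lemma D_subset: "D \<subseteq> X" and f_in: "x \<in> D \<Longrightarrow> f x \<in> X"
  using map by (auto simp: open_dense_map_def dest: openin_imp_subset)

lemma Omega_step: "x \<in> \<Omega> \<Longrightarrow> f x \<in> \<Omega>"
proof -
  assume x: "x \<in> \<Omega>"
  then have "x \<in> D" and it: "(f ^^ n) x \<notin> X - D" for n by (auto simp: Omega_inf_def)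
  then have "f x \<in> D" using f_in it[of 1] by auto
  moreover have "(f ^^ n) (f x) \<notin> X - D" for n
    using it[of "Suc n"] by (simp add: funpow_swap1)
  ultimately show "f x \<in> \<Omega>" by (simp add: Omega_inf_def)
qed

lemma Omega_iterate: "x \<in> \<Omega> \<Longrightarrow> (f ^^ n) x \<in> \<Omega>"
  by (induction n) (auto intro: Omega_step)

lemma Omega_subset: "\<Omega> \<subseteq> D"
  by (auto simp: Omega_inf_def)

lemma orbit_in_Gamma: "x \<in> \<Omega> \<Longrightarrow> (\<lambda>n. (f ^^ n) x) \<in> \<Gamma>"
  unfolding Gamma_inf_def by (rule subsetD[OF closure_subset]) simp

lemma Gamma_in_X:
  assumes "s \<in> \<Gamma>" shows "s n \<in> X"
proof -
  have "\<Gamma> \<subseteq> (\<lambda>s. s n) -` X"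
    unfolding Gamma_inf_def
  proof (rule closure_minimal)
    show "closed ((\<lambda>s :: nat \<Rightarrow> 'a. s n) -` X)"
      using compact_imp_closed[OF compact_X] by (intro closed_vimage continuous_on_coordinate)
    show "(\<lambda>x n. (f ^^ n) x) ` \<Omega> \<subseteq> (\<lambda>s. s n) -` X"
      using Omega_iterate Omega_subset D_subset by blast
  qed
  with assms show ?thesis by auto
qed

lemma compact_Gamma: "compact \<Gamma>"
proof -
  have "compactin (product_topology (\<lambda>_::nat. euclidean) UNIV) (PiE UNIV (\<lambda>_. X))"
    using compact_X by (simp add: compactin_PiE)
  then have "compact (PiE (UNIV :: nat set) (\<lambda>_. X))"
    by (simp add: euclidean_product_topology)
  moreover have "\<Gamma> \<subseteq> PiE UNIV (\<lambda>_. X)" using Gamma_in_X by auto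
  moreover have "closed \<Gamma>" by (simp add: Gamma_inf_def)
  ultimately show ?thesis using compact_Int_closed[of "PiE UNIV (\<lambda>_. X)" \<Gamma>] by (simp add: Int_absorb1)
qed

lemma shift_Gamma: "shift ` \<Gamma> \<subseteq> \<Gamma>"
  unfolding Gamma_inf_def
proof (rule image_closure_subset[OF continuous_on_shift closed_closure])
  show "shift ` (\<lambda>x n. (f ^^ n) x) ` \<Omega> \<subseteq> closure ((\<lambda>x n. (f ^^ n) x) ` \<Omega>)"
  proof safe
    fix x assume "x \<in> \<Omega>"
    then have "(\<lambda>n. (f ^^ n) (f x)) \<in> \<Gamma>" by (intro orbit_in_Gamma Omega_step)
    then show "shift (\<lambda>n. (f ^^ n) x) \<in> closure ((\<lambda>x n. (f ^^ n) x) ` \<Omega>)"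
      by (simp add: shift_def Gamma_inf_def funpow_swap1)
  qed
qed

text \<open>The image is compact, hence closed, and contains the dense set
  \<open>\<Omega>\<close>.\<close>

lemma proj1_Gamma: "proj1 ` \<Gamma> = X"
proof
  show "proj1 ` \<Gamma> \<subseteq> X" using Gamma_in_X by (auto simp: proj1_def)
  have "compact (proj1 ` \<Gamma>)"
    unfolding proj1_def by (intro compact_continuous_image continuous_on_coordinate compact_Gamma)
  moreover have "\<Omega> \<subseteq> proj1 ` \<Gamma>"
    using orbit_in_Gamma by (force simp: proj1_def intro: rev_image_eqI)
  ultimately have "closure \<Omega> \<subseteq> proj1 ` \<Gamma>" by (intro closure_minimal compact_imp_closed)
  then show "X \<subseteq> proj1 ` \<Gamma>" using good by (auto simp: good_wrt_iterates_def)
qed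

text \<open>On the orbit of a point of \<open>\<Omega>\<close>, coordinate 0 lies in
  \<open>D\<close> and coordinate 1 is its image, so the hypothesis is literally the claim. Both
  sides are continuous in \<open>s\<close>, so the inequality passes to limits of orbits.\<close>

lemma ext_comp_Gamma:
  assumes \<phi>: "continuous_on X \<phi>" and \<psi>: "continuous_on X \<psi>"
    and le: "\<forall>x\<in>X. ext_comp D f \<phi> x \<le> ereal (\<psi> x)" and s: "s \<in> \<Gamma>"
  shows "\<phi> (s 1) \<le> \<psi> (s 0)"
proof -
  obtain u where u: "\<And>k. u k \<in> (\<lambda>x n. (f ^^ n) x) ` \<Omega>" and lim: "u \<longlonglongrightarrow> s"
    using s unfolding Gamma_inf_def closure_sequential by blast
  have coord: "(\<lambda>k. \<theta> (u k n)) \<longlonglongrightarrow> \<theta> (s n)" if "continuous_on X \<theta>" for \<theta> :: "'a \<Rightarrow> real" and n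
  proof (rule continuous_on_tendsto_compose[OF that _ Gamma_in_X[OF s]])
    show "(\<lambda>k. u k n) \<longlonglongrightarrow> s n"
      using continuous_on_tendsto_compose[OF continuous_on_coordinate[of UNIV n] lim] by simp
    show "\<forall>\<^sub>F k in sequentially. u k n \<in> X"
    proof (rule always_eventually, rule allI)
      fix k
      obtain x where "x \<in> \<Omega>" "u k = (\<lambda>n. (f ^^ n) x)" using u[of k] by auto
      then show "u k n \<in> X" using Omega_iterate[of x n] Omega_subset D_subset by auto
    qed
  qed
  have "\<phi> (u k 1) \<le> \<psi> (u k 0)" for k
  proof -
    obtain x where x: "x \<in> \<Omega>" "u k = (\<lambda>n. (f ^^ n) x)" using u[of k] by auto
    then have "x \<in> D" using Omega_subset by auto
    then show ?thesis using le D_subset x(2) by (force simp: ext_comp_def)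
  qed
  then show ?thesis using LIMSEQ_le[OF coord[OF \<phi>, of 1] coord[OF \<psi>, of 0]] by auto
qed

text \<open>The gateway from \<open>fpush\<close> to the orbit space: lower bounds for
  \<open>fpush\<close> are tested on all \<open>\<psi>\<close> satisfying the inequality on
  \<open>\<Gamma>\<close>, which include all competitors in its definition. A constant bound for
  \<open>\<phi>\<close> shows that competitors exist.\<close>

lemma fpush_greatest:
  assumes \<phi>: "continuous_on X \<phi>"
    and le: "\<And>\<psi>. continuous_on X \<psi> \<Longrightarrow> (\<And>s. s \<in> \<Gamma> \<Longrightarrow> \<phi> (s 1) \<le> \<psi> (s 0)) \<Longrightarrow> a \<le> \<mu> \<psi>"
  shows "a \<le> fpush X D f \<mu> \<phi>"
  unfolding fpush_def
proof (rule cInf_greatest)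
  obtain B where "\<And>x. x \<in> X \<Longrightarrow> \<bar>\<phi> x\<bar> \<le> B" using compact_continuous_bounded[OF compact_X \<phi>] by blast
  then have B: "\<phi> (f y) \<le> B" if "y \<in> D" for y using f_in[OF that] by (force simp: abs_le_iff)
  have "ext_comp D f \<phi> x \<le> ereal B" for x
  proof -
    have "Limsup (at x within D) (\<lambda>y. ereal (\<phi> (f y))) \<le> ereal B"
      using B by (intro Limsup_bounded) (auto simp: eventually_at_filter)
    then show ?thesis using B by (simp add: ext_comp_def)
  qed
  then have "continuous_on X (\<lambda>x. B) \<and> (\<forall>x\<in>X. ext_comp D f \<phi> x \<le> ereal B)" by simp
  then show "{\<mu> \<psi> | \<psi>. continuous_on X \<psi> \<and> (\<forall>x\<in>X. ext_comp D f \<phi> x \<le> ereal (\<psi> x))} \<noteq> {}"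
    by blast
qed (use le ext_comp_Gamma[OF \<phi>] in auto)

section \<open>Transfer of invariance between \<open>f\<close> and the shift\<close>

lemma continuous_on_Gamma_proj1: "continuous_on X \<phi> \<Longrightarrow> continuous_on \<Gamma> (\<lambda>s. \<phi> (s 0))"
  for \<phi> :: "'a \<Rightarrow> real"
  by (rule continuous_on_compose2[OF _ continuous_on_coordinate]) (auto intro: Gamma_in_X)

lemma continuous_on_Gamma_shift: "continuous_on \<Gamma> \<phi> \<Longrightarrow> continuous_on \<Gamma> (\<lambda>s. \<phi> (shift s))"
  for \<phi> :: "(nat \<Rightarrow> 'a) \<Rightarrow> real"
  by (rule continuous_on_compose2[OF _ continuous_on_shift shift_Gamma])

text \<open>Shift-invariance replaces \<open>\<phi> (s 0)\<close> by \<open>\<phi> (s 1)\<close>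
  inside \<open>\<mu>\<close>, and the latter lies below \<open>\<psi> (s 0)\<close> for every
  relevant \<open>\<psi>\<close>.\<close>

lemma invariant_proj1_le_fpush:
  assumes \<mu>: "SMpos \<Gamma> \<mu>" and inv: "sm_eq \<Gamma> (push shift \<mu>) \<mu>"
  shows "sm_le X (push proj1 \<mu>) (fpush X D f (push proj1 \<mu>))"
  unfolding sm_le_def
proof (intro allI impI fpush_greatest)
  fix \<phi> \<psi> :: "'a \<Rightarrow> real" assume \<phi>: "continuous_on X \<phi>" and \<psi>: "continuous_on X \<psi>"
    and le: "\<And>s. s \<in> \<Gamma> \<Longrightarrow> \<phi> (s 1) \<le> \<psi> (s 0)"
  have "push shift \<mu> (\<lambda>s. \<phi> (s 0)) = \<mu> (\<lambda>s. \<phi> (s 0))"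
    using inv continuous_on_Gamma_proj1[OF \<phi>] unfolding sm_eq_def by blast
  then have "\<mu> (\<lambda>s. \<phi> (s 0)) = \<mu> (\<lambda>s. \<phi> (shift s 0))"
    by (simp add: push_def comp_def)
  also have "\<dots> \<le> \<mu> (\<lambda>s. \<psi> (s 0))"
    using le by (intro SMpos_mono[OF \<mu>] continuous_on_Gamma_proj1 \<psi>
        continuous_on_Gamma_shift[OF continuous_on_Gamma_proj1[OF \<phi>]]) (auto simp: shift_def)
  finally show "push proj1 \<mu> \<phi> \<le> push proj1 \<mu> \<psi>" by (simp add: push_def comp_def proj1_def)
qed

text \<open>If \<open>\<psi>\<close> competes for \<open>\<phi>\<close> and \<open>\<theta>\<close>
  for \<open>fpush\<close> at \<open>\<psi>\<close>, then
  \<open>\<phi> (shift s) \<le> \<psi> (s 1) \<le> \<theta> (s 0)\<close>, so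
  \<open>\<theta>\<close> competes for the shifted function. The infimum over
  \<open>\<theta>\<close> is \<open>\<mu> \<psi>\<close> by invariance.\<close>

lemma pull_shift_le:
  assumes \<mu>: "SMpos X \<mu>" and inv: "sm_eq X (fpush X D f \<mu>) \<mu>" and \<phi>: "continuous_on \<Gamma> \<phi>"
  shows "pull X \<Gamma> proj1 \<mu> (\<lambda>s. \<phi> (shift s)) \<le> pull X \<Gamma> proj1 \<mu> \<phi>"
proof (rule pull_greatest[OF compact_Gamma proj1_Gamma \<mu> \<phi>])
  fix \<psi> assume \<psi>: "continuous_on X \<psi>" and le: "\<And>s. s \<in> \<Gamma> \<Longrightarrow> \<phi> s \<le> \<psi> (proj1 s)"
  have "pull X \<Gamma> proj1 \<mu> (\<lambda>s. \<phi> (shift s)) \<le> fpush X D f \<mu> \<psi>"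
  proof (rule fpush_greatest[OF \<psi>])
    fix \<theta> assume \<theta>: "continuous_on X \<theta>" and le': "\<And>s. s \<in> \<Gamma> \<Longrightarrow> \<psi> (s 1) \<le> \<theta> (s 0)"
    show "pull X \<Gamma> proj1 \<mu> (\<lambda>s. \<phi> (shift s)) \<le> \<mu> \<theta>"
    proof (rule pull_le[OF compact_Gamma proj1_Gamma \<mu> continuous_on_Gamma_shift[OF \<phi>] \<theta>])
      fix s assume s: "s \<in> \<Gamma>"
      then have "shift s \<in> \<Gamma>" using shift_Gamma by auto
      from le[OF this] le'[OF s] show "\<phi> (shift s) \<le> \<theta> (proj1 s)" by (simp add: proj1_def shift_def)
    qed
  qed
  also have "\<dots> = \<mu> \<psi>" using inv \<psi> by (simp add: sm_eq_def)
  finally show "pull X \<Gamma> proj1 \<mu> (\<lambda>s. \<phi> (shift s)) \<le> \<mu> \<psi>" .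
qed

lemma exists_invariant_measure:
  assumes \<mu>: "SMpos X \<mu>" and nz: "\<exists>\<phi>. continuous_on X \<phi> \<and> \<mu> \<phi> \<noteq> 0"
    and inv: "sm_eq X (fpush X D f \<mu>) \<mu>"
  obtains M :: "(nat \<Rightarrow> 'a) measure" where
    "sets M = sets (restrict_space borel \<Gamma>)" "finite_measure M" "emeasure M (space M) \<noteq> 0"
    "SMpos \<Gamma> (\<lambda>\<phi>. integral\<^sup>L M \<phi>)"
    "sm_eq \<Gamma> (push shift (\<lambda>\<phi>. integral\<^sup>L M \<phi>)) (\<lambda>\<phi>. integral\<^sup>L M \<phi>)"
    "sm_norm \<Gamma> (\<lambda>\<phi>. integral\<^sup>L M \<phi>) = sm_norm X \<mu>"
    "sm_le X (push proj1 (\<lambda>\<phi>. integral\<^sup>L M \<phi>)) \<mu>"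
proof -
  note pull = compact_Gamma proj1_Gamma \<mu>
  obtain \<phi>0 where \<phi>0: "continuous_on X \<phi>0" "\<mu> \<phi>0 \<noteq> 0" using nz by blast
  with SMpos_abs_le[OF compact_X \<mu>] have \<mu>1: "\<mu> (\<lambda>x. 1) \<noteq> 0" by fastforce
  \<comment> \<open>On an empty space \<open>sup_norm\<close> is 0, and boundedness would make
    \<open>\<mu>\<close> vanish.\<close>
  have "X \<noteq> {}" using SMpos_bounded[OF \<mu>] \<phi>0 by (auto simp: sup_norm_def)
  then have \<Gamma>: "\<Gamma> \<noteq> {}" using proj1_Gamma by auto
  obtain L where L: "linear_functional_on {\<phi>. continuous_on \<Gamma> \<phi>} L"
    and le: "\<And>\<phi>. continuous_on \<Gamma> \<phi> \<Longrightarrow> L \<phi> \<le> pull X \<Gamma> proj1 \<mu> \<phi>"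
    and L1: "L (\<lambda>x. 1) = pull X \<Gamma> proj1 \<mu> (\<lambda>x. 1)"
    and Linv: "\<And>\<phi>. continuous_on \<Gamma> \<phi> \<Longrightarrow> L (\<lambda>s. \<phi> (shift s)) = L \<phi>"
  proof (rule exists_invariant_functional[OF compact_Gamma continuous_on_shift shift_Gamma sublinear_on_pull[OF pull]])
    show "pull X \<Gamma> proj1 \<mu> \<phi> \<le> pull X \<Gamma> proj1 \<mu> \<psi>"
      if "continuous_on \<Gamma> \<phi>" "continuous_on \<Gamma> \<psi>" "\<And>x. x \<in> \<Gamma> \<Longrightarrow> \<phi> x \<le> \<psi> x" for \<phi> \<psi>
      by (rule pull_mono[OF pull that])
    show "pull X \<Gamma> proj1 \<mu> (\<lambda>s. \<phi> (shift s)) \<le> pull X \<Gamma> proj1 \<mu> \<phi>" if "continuous_on \<Gamma> \<phi>" for \<phi>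
      by (rule pull_shift_le[OF \<mu> inv that])
  qed (rule that)
  have nonneg: "0 \<le> L \<phi>" if \<phi>: "continuous_on \<Gamma> \<phi>" "\<And>x. x \<in> \<Gamma> \<Longrightarrow> 0 \<le> \<phi> x" for \<phi>
  proof -
    have "L (\<lambda>x. -1 * \<phi> x) \<le> pull X \<Gamma> proj1 \<mu> (\<lambda>x. -1 * \<phi> x)"
      by (intro le continuous_intros \<phi>)
    also have "\<dots> \<le> pull X \<Gamma> proj1 \<mu> (\<lambda>x. 0)"
      using \<phi>(2) by (intro pull_mono[OF pull] continuous_intros \<phi>) auto
    also have "\<dots> = 0" using pull_const[OF pull] SMpos_zero[OF \<mu>] by simp
    finally have "L (\<lambda>x. -1 * \<phi> x) \<le> 0" .
    moreover have "L (\<lambda>x. -1 * \<phi> x) = -1 * L \<phi>"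
      using L \<phi>(1) unfolding linear_functional_on_def by blast
    ultimately show ?thesis by simp
  qed
  obtain M where M: "sets M = sets (restrict_space borel \<Gamma>)" "finite_measure M"
    and int: "\<And>\<phi>. continuous_on \<Gamma> \<phi> \<Longrightarrow> integral\<^sup>L M \<phi> = L \<phi>"
    using Riesz_representation_compact[OF compact_Gamma L nonneg] by metis
  have intL: "SMpos \<Gamma> (\<lambda>\<phi>. integral\<^sup>L M \<phi>)"
    using SMpos_positive_linear[OF compact_Gamma L nonneg] unfolding SMpos_def
    by (simp add: int continuous_on_add continuous_on_mult_left)
  \<comment> \<open>The total mass: it yields both the non-vanishing of \<open>M\<close> and the
    equality of norms.\<close>
  have int1: "integral\<^sup>L M (\<lambda>x. 1) = \<mu> (\<lambda>x. 1)"
    using int[of "\<lambda>x. 1"] L1 pull_const[OF pull] by simp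
  show ?thesis
  proof (rule that[OF M _ intL])
    show "emeasure M (space M) \<noteq> 0"
      using int1 \<mu>1 by (auto simp: measure_def)
    show "sm_eq \<Gamma> (push shift (\<lambda>\<phi>. integral\<^sup>L M \<phi>)) (\<lambda>\<phi>. integral\<^sup>L M \<phi>)"
      by (simp add: sm_eq_def push_def comp_def int Linv continuous_on_Gamma_shift)
    show "sm_norm \<Gamma> (\<lambda>\<phi>. integral\<^sup>L M \<phi>) = sm_norm X \<mu>"
      using sm_norm_eq[OF compact_Gamma \<Gamma> intL] sm_norm_eq[OF compact_X \<open>X \<noteq> {}\<close> \<mu>] int1 by simp
    show "sm_le X (push proj1 (\<lambda>\<phi>. integral\<^sup>L M \<phi>)) \<mu>"
      unfolding sm_le_def
    proof (intro allI impI)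
      fix \<phi> :: "'a \<Rightarrow> real" assume \<phi>: "continuous_on X \<phi>"
      note cont = continuous_on_Gamma_proj1[OF \<phi>]
      have "L (\<lambda>s. \<phi> (s 0)) \<le> \<mu> \<phi>"
        using le[OF cont] pull_le[OF pull cont \<phi>] by (simp add: proj1_def)
      then show "push proj1 (\<lambda>\<phi>. integral\<^sup>L M \<phi>) \<phi> \<le> \<mu> \<phi>"
        by (simp add: push_def comp_def proj1_def int cont)
    qed
  qed
qed

text \<open>Both side conditions compare values at fixed functions, so they survive pointwise
  suprema. The constraint on the push-forward, tested at 1, bounds all competitors by
  \<open>\<mu> 1\<close>; the assumed competitor makes the family non-empty.\<close>

lemma exists_largest_invariant:
  assumes ex: "\<exists>\<nu>. SMpos \<Gamma> \<nu> \<and> sm_le X (push proj1 \<nu>) \<mu> \<and> sm_eq \<Gamma> (push shift \<nu>) \<nu>"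
  shows "\<exists>\<mu>max. SMpos \<Gamma> \<mu>max \<and> sm_le X (push proj1 \<mu>max) \<mu> \<and> sm_eq \<Gamma> (push shift \<mu>max) \<mu>max \<and>
      (\<forall>\<nu>. SMpos \<Gamma> \<nu> \<and> sm_le X (push proj1 \<nu>) \<mu> \<and> sm_eq \<Gamma> (push shift \<nu>) \<nu> \<longrightarrow> sm_le \<Gamma> \<nu> \<mu>max)"
proof -
  define I where "I = {\<nu>. SMpos \<Gamma> \<nu> \<and> sm_le X (push proj1 \<nu>) \<mu> \<and> sm_eq \<Gamma> (push shift \<nu>) \<nu>}"
  have "I \<noteq> {}" using ex by (auto simp: I_def)
  have SM: "SMpos \<Gamma> \<nu>" and le: "continuous_on X \<phi> \<Longrightarrow> \<nu> (\<lambda>s. \<phi> (s 0)) \<le> \<mu> \<phi>"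
    and inv: "continuous_on \<Gamma> \<psi> \<Longrightarrow> \<nu> (\<lambda>s. \<psi> (shift s)) = \<nu> \<psi>" if "\<nu> \<in> I" for \<nu> \<phi> \<psi>
    using that by (auto simp: I_def sm_le_def sm_eq_def push_def comp_def proj1_def)
  have one: "\<nu> (\<lambda>x. 1) \<le> \<mu> (\<lambda>x. 1)" if "\<nu> \<in> I" for \<nu>
    using le[OF that, of "\<lambda>x. 1"] by simp
  have SUP: "SMpos \<Gamma> (\<lambda>\<phi>. SUP \<nu>\<in>I. \<nu> \<phi>)"
    by (rule SMpos_SUP(1)[OF compact_Gamma \<open>I \<noteq> {}\<close>]) (erule SM one)+
  have upper: "\<nu> \<phi> \<le> (SUP \<nu>\<in>I. \<nu> \<phi>)" if "\<nu> \<in> I" "continuous_on \<Gamma> \<phi>" for \<nu> \<phi>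
    by (rule SMpos_SUP(2)[OF compact_Gamma \<open>I \<noteq> {}\<close> _ _ that]) (erule SM one)+
  show ?thesis
  proof (intro exI conjI allI impI)
    show "SMpos \<Gamma> (\<lambda>\<phi>. SUP \<nu>\<in>I. \<nu> \<phi>)" by (rule SUP)
    show "sm_le X (push proj1 (\<lambda>\<phi>. SUP \<nu>\<in>I. \<nu> \<phi>)) \<mu>"
      using \<open>I \<noteq> {}\<close> le by (auto simp: sm_le_def push_def comp_def proj1_def intro!: cSUP_least)
    show "sm_eq \<Gamma> (push shift (\<lambda>\<phi>. SUP \<nu>\<in>I. \<nu> \<phi>)) (\<lambda>\<phi>. SUP \<nu>\<in>I. \<nu> \<phi>)"
      using inv by (auto simp: sm_eq_def push_def comp_def intro!: SUP_cong)
    fix \<nu> assume "SMpos \<Gamma> \<nu> \<and> sm_le X (push proj1 \<nu>) \<mu> \<and> sm_eq \<Gamma> (push shift \<nu>) \<nu>"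
    then have "\<nu> \<in> I" by (simp add: I_def)
    then show "sm_le \<Gamma> \<nu> (\<lambda>\<phi>. SUP \<nu>\<in>I. \<nu> \<phi>)"
      using upper by (simp add: sm_le_def)
  qed
qed

end

theorem theorem3p2:
  fixes X D :: "'a::metric_space set" and f :: "'a \<Rightarrow> 'a"
  assumes "compact X"
    and "open_dense_map X D f"
    and "good_wrt_iterates X D f"
  shows
    "(\<forall>\<mu>h. SMpos (Gamma_inf X D f) \<mu>h \<and> sm_eq (Gamma_inf X D f) (push shift \<mu>h) \<mu>h \<longrightarrow>
        sm_le X (push proj1 \<mu>h) (fpush X D f (push proj1 \<mu>h)))
     \<and>
     (\<forall>\<mu>0. SMpos X \<mu>0 \<and> (\<exists>\<phi>. continuous_on X \<phi> \<and> \<mu>0 \<phi> \<noteq> 0) \<and>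
           sm_eq X (fpush X D f \<mu>0) \<mu>0 \<longrightarrow>
        (\<exists>M :: (nat \<Rightarrow> 'a) measure.
            sets M = sets (restrict_space borel (Gamma_inf X D f)) \<and> finite_measure M \<and>
            emeasure M (space M) \<noteq> 0 \<and>
            sm_eq (Gamma_inf X D f) (push shift (\<lambda>\<phi>. integral\<^sup>L M \<phi>)) (\<lambda>\<phi>. integral\<^sup>L M \<phi>) \<and>
            sm_norm (Gamma_inf X D f) (\<lambda>\<phi>. integral\<^sup>L M \<phi>) = sm_norm X \<mu>0 \<and>
            sm_le X (push proj1 (\<lambda>\<phi>. integral\<^sup>L M \<phi>)) \<mu>0)
        \<and>
        (\<exists>\<mu>max. SMpos (Gamma_inf X D f) \<mu>max \<and> sm_le X (push proj1 \<mu>max) \<mu>0 \<and>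
                sm_eq (Gamma_inf X D f) (push shift \<mu>max) \<mu>max \<and>
                (\<forall>\<nu>. SMpos (Gamma_inf X D f) \<nu> \<and> sm_le X (push proj1 \<nu>) \<mu>0 \<and>
                     sm_eq (Gamma_inf X D f) (push shift \<nu>) \<nu> \<longrightarrow>
                     sm_le (Gamma_inf X D f) \<nu> \<mu>max)))"
proof -
  interpret good_map X D f by (rule good_map.intro; fact)
  show ?thesis
  proof (intro conjI allI impI; elim conjE)
    fix \<mu>
    assume \<mu>: "SMpos X \<mu>" "\<exists>\<phi>. continuous_on X \<phi> \<and> \<mu> \<phi> \<noteq> 0" "sm_eq X (fpush X D f \<mu>) \<mu>"
    obtain M :: "(nat \<Rightarrow> 'a) measure" where M: "sets M = sets (restrict_space borel \<Gamma>)" "finite_measure M"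
        "emeasure M (space M) \<noteq> 0" "SMpos \<Gamma> (\<lambda>\<phi>. integral\<^sup>L M \<phi>)"
        "sm_eq \<Gamma> (push shift (\<lambda>\<phi>. integral\<^sup>L M \<phi>)) (\<lambda>\<phi>. integral\<^sup>L M \<phi>)"
        "sm_norm \<Gamma> (\<lambda>\<phi>. integral\<^sup>L M \<phi>) = sm_norm X \<mu>"
        "sm_le X (push proj1 (\<lambda>\<phi>. integral\<^sup>L M \<phi>)) \<mu>"
      by (rule exists_invariant_measure[OF \<mu>])
    then show "\<exists>M :: (nat \<Rightarrow> 'a) measure. sets M = sets (restrict_space borel \<Gamma>) \<and> finite_measure M \<and>
        emeasure M (space M) \<noteq> 0 \<and>
        sm_eq \<Gamma> (push shift (\<lambda>\<phi>. integral\<^sup>L M \<phi>)) (\<lambda>\<phi>. integral\<^sup>L M \<phi>) \<and>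
        sm_norm \<Gamma> (\<lambda>\<phi>. integral\<^sup>L M \<phi>) = sm_norm X \<mu> \<and>
        sm_le X (push proj1 (\<lambda>\<phi>. integral\<^sup>L M \<phi>)) \<mu>"
      by blast
    show "\<exists>\<mu>max. SMpos \<Gamma> \<mu>max \<and> sm_le X (push proj1 \<mu>max) \<mu> \<and> sm_eq \<Gamma> (push shift \<mu>max) \<mu>max \<and>
        (\<forall>\<nu>. SMpos \<Gamma> \<nu> \<and> sm_le X (push proj1 \<nu>) \<mu> \<and> sm_eq \<Gamma> (push shift \<nu>) \<nu> \<longrightarrow> sm_le \<Gamma> \<nu> \<mu>max)"
      using M by (intro exists_largest_invariant exI[of _ "\<lambda>\<phi>. integral\<^sup>L M \<phi>"]) simp
  qed (rule invariant_proj1_le_fpush)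
qed

end
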